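(* Let $\mathcal{A}$ and $\mathcal{B}$ be abelian categories and let $F:\mathcal{A}\to\mathcal{B}$ be a faithful additive functor with left adjoint $L$ and right adjoint $R$, such that the classes of $F$-projective and $F$-injective objects of $\mathcal{A}$ coincide. Let $X$ be a bounded above cochain complex in $\mathrm{K}(\mathcal{A})$. Then $X$ has an $F$-projective resolution.
   Context: An object of $\mathcal{A}$ is $F$-projective if it is a direct summand of $LY$ for some $Y\in\mathcal{B}$, and $F$-injective if it is a direct summand of $RY$ for some $Y\in\mathcal{B}$. $\mathrm{K}(\mathcal{A})$ denotes the unbounded homotopy category of cochain complexes over $\mathcal{A}$. The functor $F$ is exact and induces $F:\mathrm{K}(\mathcal{A})\to\mathrm{K}(\mathcal{B})$; let $\mathcal{L}$ be the kernel of this induced functor, i.e. the complexes $S$ such that $FS$ is split acyclic (contractible). Such complexes are called $F$-split acyclic. Set $D_F(\mathcal{A}):=\mathrm{K}(\mathcal{A})/\mathcal{L}$ (Verdier localization). An $F$-projective resolution of a cochain complex $X$ is a complex $P$ all of whose terms are $F$-projective, together with a map of complexes $p:P\to X$ (in the category of complexes) such that the cone of $p$ is zero in $D_F(\mathcal{A})$. *)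

theory Defs
  imports "HOL-Algebra.Group"
begin

record ('o, 'm) category =
  Ob :: "'o set"
  Hom :: "'o \<Rightarrow> 'o \<Rightarrow> 'm set"
  Id :: "'o \<Rightarrow> 'm"
  Comp :: "'m \<Rightarrow> 'm \<Rightarrow> 'm" (infixl "\<cdot>\<index>" 70)

text \<open>Composition is written in the order \<open>g \<cdot> f\<close> (first \<open>f\<close>, then \<open>g\<close>).  Distinct hom-sets are
  disjoint, so that an arrow determines its source and target.\<close>

locale category =
  fixes C :: "('o, 'm, 'z) category_scheme" (structure)
  assumes Hom_Ob: "f \<in> Hom C X Y \<Longrightarrow> X \<in> Ob C \<and> Y \<in> Ob C"
    and Hom_disjoint: "f \<in> Hom C X Y \<Longrightarrow> f \<in> Hom C X' Y' \<Longrightarrow> X = X' \<and> Y = Y'"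
    and Id_in: "X \<in> Ob C \<Longrightarrow> Id C X \<in> Hom C X X"
    and Comp_in: "f \<in> Hom C X Y \<Longrightarrow> g \<in> Hom C Y Z \<Longrightarrow> g \<cdot> f \<in> Hom C X Z"
    and Comp_Id: "f \<in> Hom C X Y \<Longrightarrow> f \<cdot> Id C X = f"
    and Id_Comp: "f \<in> Hom C X Y \<Longrightarrow> Id C Y \<cdot> f = f"
    and Comp_assoc: "f \<in> Hom C W X \<Longrightarrow> g \<in> Hom C X Y \<Longrightarrow> h \<in> Hom C Y Z \<Longrightarrow>
           h \<cdot> (g \<cdot> f) = (h \<cdot> g) \<cdot> f"

definition zero_object :: "('o, 'm, 'z) category_scheme \<Rightarrow> 'o \<Rightarrow> bool" where
  "zero_object C X \<longleftrightarrow> X \<in> Ob C \<and>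
     (\<forall>Y \<in> Ob C. (\<exists>!f. f \<in> Hom C X Y) \<and> (\<exists>!f. f \<in> Hom C Y X))"

definition monic :: "('o, 'm, 'z) category_scheme \<Rightarrow> 'o \<Rightarrow> 'o \<Rightarrow> 'm \<Rightarrow> bool" where
  "monic C X Y f \<longleftrightarrow> f \<in> Hom C X Y \<and>
     (\<forall>Z. \<forall>g \<in> Hom C Z X. \<forall>h \<in> Hom C Z X. f \<cdot>\<^bsub>C\<^esub> g = f \<cdot>\<^bsub>C\<^esub> h \<longrightarrow> g = h)"

definition epic :: "('o, 'm, 'z) category_scheme \<Rightarrow> 'o \<Rightarrow> 'o \<Rightarrow> 'm \<Rightarrow> bool" where
  "epic C X Y f \<longleftrightarrow> f \<in> Hom C X Y \<and>
     (\<forall>Z. \<forall>g \<in> Hom C Y Z. \<forall>h \<in> Hom C Y Z. g \<cdot>\<^bsub>C\<^esub> f = h \<cdot>\<^bsub>C\<^esub> f \<longrightarrow> g = h)"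

text \<open>The addition of arrows is carried as data.  In an abelian category it is determined by
  the underlying category.\<close>

record ('o, 'm) preadditive_category = "('o, 'm) category" +
  Add :: "'m \<Rightarrow> 'm \<Rightarrow> 'm" (infixl "\<boxplus>\<index>" 65)
  Zero :: "'o \<Rightarrow> 'o \<Rightarrow> 'm"

definition hom_group :: "('o, 'm, 'z) preadditive_category_scheme \<Rightarrow> 'o \<Rightarrow> 'o \<Rightarrow> 'm monoid" where
  "hom_group C X Y = \<lparr>carrier = Hom C X Y, mult = Add C, one = Zero C X Y\<rparr>"

abbreviation Neg :: "('o, 'm, 'z) preadditive_category_scheme \<Rightarrow> 'o \<Rightarrow> 'o \<Rightarrow> 'm \<Rightarrow> 'm" where
  "Neg C X Y f \<equiv> inv\<^bsub>hom_group C X Y\<^esub> f"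

locale preadditive_category = category C
  for C :: "('o, 'm, 'z) preadditive_category_scheme" (structure) +
  assumes hom_comm_group: "X \<in> Ob C \<Longrightarrow> Y \<in> Ob C \<Longrightarrow> comm_group (hom_group C X Y)"
    and Comp_Add: "f \<in> Hom C X Y \<Longrightarrow> f' \<in> Hom C X Y \<Longrightarrow> g \<in> Hom C Y Z \<Longrightarrow>
           g \<cdot> (f \<boxplus> f') = g \<cdot> f \<boxplus> g \<cdot> f'"
    and Add_Comp: "f \<in> Hom C X Y \<Longrightarrow> g \<in> Hom C Y Z \<Longrightarrow> g' \<in> Hom C Y Z \<Longrightarrow>
           (g \<boxplus> g') \<cdot> f = g \<cdot> f \<boxplus> g' \<cdot> f"

record ('o, 'm) biproduct =
  vertex :: 'o
  in1 :: 'm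
  in2 :: 'm
  pr1 :: 'm
  pr2 :: 'm

definition is_biproduct ::
  "('o, 'm, 'z) preadditive_category_scheme \<Rightarrow> 'o \<Rightarrow> 'o \<Rightarrow> ('o, 'm) biproduct \<Rightarrow> bool" where
  "is_biproduct C X Y S \<longleftrightarrow>
     in1 S \<in> Hom C X (vertex S) \<and> in2 S \<in> Hom C Y (vertex S) \<and>
     pr1 S \<in> Hom C (vertex S) X \<and> pr2 S \<in> Hom C (vertex S) Y \<and>
     pr1 S \<cdot>\<^bsub>C\<^esub> in1 S = Id C X \<and> pr2 S \<cdot>\<^bsub>C\<^esub> in2 S = Id C Y \<and>
     pr1 S \<cdot>\<^bsub>C\<^esub> in2 S = Zero C Y X \<and> pr2 S \<cdot>\<^bsub>C\<^esub> in1 S = Zero C X Y \<and>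
     in1 S \<cdot>\<^bsub>C\<^esub> pr1 S \<boxplus>\<^bsub>C\<^esub> in2 S \<cdot>\<^bsub>C\<^esub> pr2 S = Id C (vertex S)"

definition is_kernel ::
  "('o, 'm, 'z) preadditive_category_scheme \<Rightarrow> 'o \<Rightarrow> 'o \<Rightarrow> 'm \<Rightarrow> 'o \<Rightarrow> 'm \<Rightarrow> bool" where
  "is_kernel C X Y f K k \<longleftrightarrow> f \<in> Hom C X Y \<and> k \<in> Hom C K X \<and> f \<cdot>\<^bsub>C\<^esub> k = Zero C K Y \<and>
     (\<forall>Z. \<forall>g \<in> Hom C Z X. f \<cdot>\<^bsub>C\<^esub> g = Zero C Z Y \<longrightarrow> (\<exists>!h. h \<in> Hom C Z K \<and> k \<cdot>\<^bsub>C\<^esub> h = g))"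

definition is_cokernel ::
  "('o, 'm, 'z) preadditive_category_scheme \<Rightarrow> 'o \<Rightarrow> 'o \<Rightarrow> 'm \<Rightarrow> 'o \<Rightarrow> 'm \<Rightarrow> bool" where
  "is_cokernel C X Y f Q q \<longleftrightarrow> f \<in> Hom C X Y \<and> q \<in> Hom C Y Q \<and> q \<cdot>\<^bsub>C\<^esub> f = Zero C X Q \<and>
     (\<forall>Z. \<forall>g \<in> Hom C Y Z. g \<cdot>\<^bsub>C\<^esub> f = Zero C X Z \<longrightarrow> (\<exists>!h. h \<in> Hom C Q Z \<and> h \<cdot>\<^bsub>C\<^esub> q = g))"

locale abelian_category = preadditive_category C
  for C :: "('o, 'm, 'z) preadditive_category_scheme" (structure) +
  assumes ex_zero_object: "\<exists>X. zero_object C X"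
    and ex_biproduct: "X \<in> Ob C \<Longrightarrow> Y \<in> Ob C \<Longrightarrow> \<exists>S. is_biproduct C X Y S"
    and ex_kernel: "f \<in> Hom C X Y \<Longrightarrow> \<exists>K k. is_kernel C X Y f K k"
    and ex_cokernel: "f \<in> Hom C X Y \<Longrightarrow> \<exists>Q q. is_cokernel C X Y f Q q"
    and monic_is_kernel: "monic C X Y f \<Longrightarrow> \<exists>Z g. is_kernel C Y Z g X f"
    and epic_is_cokernel: "epic C X Y f \<Longrightarrow> \<exists>W g. is_cokernel C W X g Y f"

definition direct_summand ::
  "('o, 'm, 'z) preadditive_category_scheme \<Rightarrow> 'o \<Rightarrow> 'o \<Rightarrow> bool" where
  "direct_summand C X M \<longleftrightarrow> (\<exists>Y S. is_biproduct C X Y S \<and> vertex S = M)"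

definition biprod ::
  "('o, 'm, 'z) preadditive_category_scheme \<Rightarrow> 'o \<Rightarrow> 'o \<Rightarrow> ('o, 'm) biproduct" where
  "biprod C X Y = (SOME S. is_biproduct C X Y S)"

record ('o, 'm, 'p, 'n) functor_data =
  on_ob :: "'o \<Rightarrow> 'p"
  on_hom :: "'m \<Rightarrow> 'n"

locale is_functor =
  fixes C :: "('o, 'm, 'y) category_scheme"
    and D :: "('p, 'n, 'z) category_scheme"
    and F :: "('o, 'm, 'p, 'n) functor_data"
  assumes on_ob_in: "X \<in> Ob C \<Longrightarrow> on_ob F X \<in> Ob D"
    and on_hom_in: "f \<in> Hom C X Y \<Longrightarrow> on_hom F f \<in> Hom D (on_ob F X) (on_ob F Y)"
    and on_hom_Id: "X \<in> Ob C \<Longrightarrow> on_hom F (Id C X) = Id D (on_ob F X)"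
    and on_hom_Comp: "f \<in> Hom C X Y \<Longrightarrow> g \<in> Hom C Y Z \<Longrightarrow>
           on_hom F (g \<cdot>\<^bsub>C\<^esub> f) = on_hom F g \<cdot>\<^bsub>D\<^esub> on_hom F f"

locale additive_functor = is_functor C D F
  for C :: "('o, 'm, 'y) preadditive_category_scheme"
    and D :: "('p, 'n, 'z) preadditive_category_scheme"
    and F :: "('o, 'm, 'p, 'n) functor_data" +
  assumes on_hom_Add: "f \<in> Hom C X Y \<Longrightarrow> g \<in> Hom C X Y \<Longrightarrow>
           on_hom F (f \<boxplus>\<^bsub>C\<^esub> g) = on_hom F f \<boxplus>\<^bsub>D\<^esub> on_hom F g"

definition faithful ::
  "('o, 'm, 'z) category_scheme \<Rightarrow> ('o, 'm, 'p, 'n) functor_data \<Rightarrow> bool" where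
  "faithful C F \<longleftrightarrow> (\<forall>X \<in> Ob C. \<forall>Y \<in> Ob C. inj_on (on_hom F) (Hom C X Y))"

text \<open>\<open>adjunction C D L R\<close>: the functor \<open>L : C \<rightarrow> D\<close> is left adjoint to \<open>R : D \<rightarrow> C\<close>, that is,
  there are bijections \<open>Hom D (L X) Y \<rightarrow> Hom C X (R Y)\<close> natural in \<open>X\<close> and in \<open>Y\<close>.\<close>

definition adjunction ::
  "('o, 'm, 'y) category_scheme \<Rightarrow> ('p, 'n, 'z) category_scheme \<Rightarrow>
   ('o, 'm, 'p, 'n) functor_data \<Rightarrow> ('p, 'n, 'o, 'm) functor_data \<Rightarrow> bool" where
  "adjunction C D L R \<longleftrightarrow> is_functor C D L \<and> is_functor D C R \<and>
     (\<exists>\<phi> :: 'o \<Rightarrow> 'p \<Rightarrow> 'n \<Rightarrow> 'm.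
        (\<forall>X \<in> Ob C. \<forall>Y \<in> Ob D. bij_betw (\<phi> X Y) (Hom D (on_ob L X) Y) (Hom C X (on_ob R Y))) \<and>
        (\<forall>X X' Y. \<forall>f \<in> Hom D (on_ob L X) Y. \<forall>a \<in> Hom C X' X. X \<in> Ob C \<longrightarrow>
           \<phi> X' Y (f \<cdot>\<^bsub>D\<^esub> on_hom L a) = \<phi> X Y f \<cdot>\<^bsub>C\<^esub> a) \<and>
        (\<forall>X Y Y'. \<forall>f \<in> Hom D (on_ob L X) Y. \<forall>b \<in> Hom D Y Y'. X \<in> Ob C \<longrightarrow>
           \<phi> X Y' (b \<cdot>\<^bsub>D\<^esub> f) = on_hom R b \<cdot>\<^bsub>C\<^esub> \<phi> X Y f))"

definition F_projective ::
  "('o, 'm, 'y) preadditive_category_scheme \<Rightarrow> ('p, 'n, 'z) category_scheme \<Rightarrow>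
   ('p, 'n, 'o, 'm) functor_data \<Rightarrow> 'o \<Rightarrow> bool" where
  "F_projective A B L P \<longleftrightarrow> (\<exists>Y \<in> Ob B. direct_summand A P (on_ob L Y))"

definition F_injective ::
  "('o, 'm, 'y) preadditive_category_scheme \<Rightarrow> ('p, 'n, 'z) category_scheme \<Rightarrow>
   ('p, 'n, 'o, 'm) functor_data \<Rightarrow> 'o \<Rightarrow> bool" where
  "F_injective A B R I \<longleftrightarrow> (\<exists>Y \<in> Ob B. direct_summand A I (on_ob R Y))"

record ('o, 'm) complex_data =
  Term :: "int \<Rightarrow> 'o"
  Diff :: "int \<Rightarrow> 'm"

definition cochain_complex ::
  "('o, 'm, 'z) preadditive_category_scheme \<Rightarrow> ('o, 'm) complex_data \<Rightarrow> bool" where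
  "cochain_complex A X \<longleftrightarrow> (\<forall>n. Term X n \<in> Ob A \<and> Diff X n \<in> Hom A (Term X n) (Term X (n + 1)) \<and>
     Diff X (n + 1) \<cdot>\<^bsub>A\<^esub> Diff X n = Zero A (Term X n) (Term X (n + 2)))"

definition bounded_above ::
  "('o, 'm, 'z) preadditive_category_scheme \<Rightarrow> ('o, 'm) complex_data \<Rightarrow> bool" where
  "bounded_above A X \<longleftrightarrow> (\<exists>N. \<forall>n > N. zero_object A (Term X n))"

definition chain_maps ::
  "('o, 'm, 'z) preadditive_category_scheme \<Rightarrow> ('o, 'm) complex_data \<Rightarrow> ('o, 'm) complex_data \<Rightarrow>
   (int \<Rightarrow> 'm) set" where
  "chain_maps A X Y = {f. cochain_complex A X \<and> cochain_complex A Y \<and>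
     (\<forall>n. f n \<in> Hom A (Term X n) (Term Y n) \<and>
          Diff Y n \<cdot>\<^bsub>A\<^esub> f n = f (n + 1) \<cdot>\<^bsub>A\<^esub> Diff X n)}"

definition homotopy_rel ::
  "('o, 'm, 'z) preadditive_category_scheme \<Rightarrow> ('o, 'm) complex_data \<Rightarrow> ('o, 'm) complex_data \<Rightarrow>
   (int \<Rightarrow> 'm) rel" where
  "homotopy_rel A X Y = {(f, g). f \<in> chain_maps A X Y \<and> g \<in> chain_maps A X Y \<and>
     (\<exists>h. (\<forall>n. h n \<in> Hom A (Term X n) (Term Y (n - 1))) \<and>
          (\<forall>n. g n = f n \<boxplus>\<^bsub>A\<^esub> (Diff Y (n - 1) \<cdot>\<^bsub>A\<^esub> h n \<boxplus>\<^bsub>A\<^esub> h (n + 1) \<cdot>\<^bsub>A\<^esub> Diff X n)))}"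

text \<open>An arrow of the homotopy category is a homotopy class of chain maps, tagged with its source
  and target; the composite of two classes consists of all chain maps homotopic to a composite of
  representatives.\<close>

type_synonym ('o, 'm) homotopy_arrow =
  "('o, 'm) complex_data \<times> ('o, 'm) complex_data \<times> (int \<Rightarrow> 'm) set"

definition homotopy_category ::
  "('o, 'm, 'z) preadditive_category_scheme \<Rightarrow>
   (('o, 'm) complex_data, ('o, 'm) homotopy_arrow) category" where
  "homotopy_category A =
     \<lparr>Ob = {X. cochain_complex A X},
      Hom = (\<lambda>X Y. {(X, Y, \<alpha>) |\<alpha>. \<alpha> \<in> chain_maps A X Y // homotopy_rel A X Y}),
      Id = (\<lambda>X. (X, X, homotopy_rel A X X `` {\<lambda>n. Id A (Term X n)})),
      Comp = (\<lambda>(_, Z, \<beta>) (X, _, \<alpha>). (X, Z, homotopy_rel A X Z `` {\<lambda>n. g n \<cdot>\<^bsub>A\<^esub> f n |g f. g \<in> \<beta> \<and> f \<in> \<alpha>}))\<rparr>"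

definition contractible ::
  "('o, 'm, 'z) preadditive_category_scheme \<Rightarrow> ('o, 'm) complex_data \<Rightarrow> bool" where
  "contractible A X \<longleftrightarrow>
     ((\<lambda>n. Id A (Term X n)), (\<lambda>n. Zero A (Term X n) (Term X n))) \<in> homotopy_rel A X X"

text \<open>The mapping cone of \<open>f : X \<rightarrow> Y\<close> has \<open>n\<close>-th term \<open>X (n + 1) \<oplus> Y n\<close> and differential
  \<open>(x, y) \<mapsto> (- d x, f x + d y)\<close>.\<close>

definition cone ::
  "('o, 'm, 'z) preadditive_category_scheme \<Rightarrow> ('o, 'm) complex_data \<Rightarrow> ('o, 'm) complex_data \<Rightarrow>
   (int \<Rightarrow> 'm) \<Rightarrow> ('o, 'm) complex_data" where
  "cone A X Y f =
     (let S = (\<lambda>n. biprod A (Term X (n + 1)) (Term Y n)) in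
      \<lparr>Term = (\<lambda>n. vertex (S n)),
       Diff = (\<lambda>n.
         in1 (S (n + 1)) \<cdot>\<^bsub>A\<^esub> Neg A (Term X (n + 1)) (Term X (n + 2)) (Diff X (n + 1)) \<cdot>\<^bsub>A\<^esub> pr1 (S n)
         \<boxplus>\<^bsub>A\<^esub> in2 (S (n + 1)) \<cdot>\<^bsub>A\<^esub> (f (n + 1) \<cdot>\<^bsub>A\<^esub> pr1 (S n) \<boxplus>\<^bsub>A\<^esub> Diff Y n \<cdot>\<^bsub>A\<^esub> pr2 (S n)))\<rparr>)"

text \<open>For a category \<open>C\<close> with a multiplicative system \<open>W\<close> of arrows, the arrows \<open>X \<rightarrow> Y\<close> of the
  localization are equivalence classes of roofs \<open>X \<leftarrow> Z \<rightarrow> Y\<close> (the left leg in \<open>W\<close>).  Two roofs are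
  equivalent when they have a common refinement.  The composite of two classes consists of all
  roofs equivalent to one obtained from representatives by completing a square.\<close>

definition roofs :: "('o, 'm, 'z) category_scheme \<Rightarrow> 'm set \<Rightarrow> 'o \<Rightarrow> 'o \<Rightarrow> ('m \<times> 'm) set" where
  "roofs C W X Y = {(s, f). s \<in> W \<and> (\<exists>Z. s \<in> Hom C Z X \<and> f \<in> Hom C Z Y)}"

definition roof_rel :: "('o, 'm, 'z) category_scheme \<Rightarrow> 'm set \<Rightarrow> 'o \<Rightarrow> 'o \<Rightarrow> ('m \<times> 'm) rel" where
  "roof_rel C W X Y = {((s, f), (s', f')).
     (s, f) \<in> roofs C W X Y \<and> (s', f') \<in> roofs C W X Y \<and>
     (\<exists>Z Z' V. \<exists>u \<in> Hom C V Z. \<exists>u' \<in> Hom C V Z'.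
        s \<in> Hom C Z X \<and> s' \<in> Hom C Z' X \<and>
        s \<cdot>\<^bsub>C\<^esub> u = s' \<cdot>\<^bsub>C\<^esub> u' \<and> s \<cdot>\<^bsub>C\<^esub> u \<in> W \<and> f \<cdot>\<^bsub>C\<^esub> u = f' \<cdot>\<^bsub>C\<^esub> u')}"

definition roof_composites ::
  "('o, 'm, 'z) category_scheme \<Rightarrow> 'm set \<Rightarrow> ('m \<times> 'm) set \<Rightarrow> ('m \<times> 'm) set \<Rightarrow> ('m \<times> 'm) set" where
  "roof_composites C W \<beta> \<alpha> = {(s \<cdot>\<^bsub>C\<^esub> u, g \<cdot>\<^bsub>C\<^esub> v) |s f t g u v.
     (s, f) \<in> \<alpha> \<and> (t, g) \<in> \<beta> \<and> u \<in> W \<and> f \<cdot>\<^bsub>C\<^esub> u = t \<cdot>\<^bsub>C\<^esub> v \<and>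
     (\<exists>V Z Z' X Y. u \<in> Hom C V Z \<and> s \<in> Hom C Z X \<and> v \<in> Hom C V Z' \<and> t \<in> Hom C Z' Y)}"

definition localization ::
  "('o, 'm, 'z) category_scheme \<Rightarrow> 'm set \<Rightarrow> ('o, 'o \<times> 'o \<times> ('m \<times> 'm) set) category" where
  "localization C W =
     \<lparr>Ob = Ob C,
      Hom = (\<lambda>X Y. {(X, Y, \<alpha>) |\<alpha>. X \<in> Ob C \<and> Y \<in> Ob C \<and> \<alpha> \<in> roofs C W X Y // roof_rel C W X Y}),
      Id = (\<lambda>X. (X, X, roof_rel C W X X `` {(Id C X, Id C X)})),
      Comp = (\<lambda>(_, Z, \<beta>) (X, _, \<alpha>). (X, Z, roof_rel C W X Z `` roof_composites C W \<beta> \<alpha>))\<rparr>"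

text \<open>The Verdier localization of the homotopy category at a triangulated subcategory, given by
  the set \<open>N\<close> of its objects: the arrows whose cone lies in \<open>N\<close> are inverted.  The cone of a
  homotopy class is determined only up to isomorphism in the homotopy category, and \<open>N\<close> is assumed
  to be closed under isomorphism there, so any representative will do.\<close>

definition verdier_localization ::
  "('o, 'm, 'z) preadditive_category_scheme \<Rightarrow> ('o, 'm) complex_data set \<Rightarrow>
   (('o, 'm) complex_data,
    ('o, 'm) complex_data \<times> ('o, 'm) complex_data \<times>
      (('o, 'm) homotopy_arrow \<times> ('o, 'm) homotopy_arrow) set) category" where
  "verdier_localization A N =
     localization (homotopy_category A)
       {(X, Y, \<alpha>) |X Y \<alpha>. (X, Y, \<alpha>) \<in> Hom (homotopy_category A) X Y \<and> (\<exists>f \<in> \<alpha>. cone A X Y f \<in> N)}"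

definition map_complex ::
  "('o, 'm, 'p, 'n) functor_data \<Rightarrow> ('o, 'm) complex_data \<Rightarrow> ('p, 'n) complex_data" where
  "map_complex F X = \<lparr>Term = (\<lambda>n. on_ob F (Term X n)), Diff = (\<lambda>n. on_hom F (Diff X n))\<rparr>"

definition F_split_acyclic ::
  "('o, 'm, 'y) preadditive_category_scheme \<Rightarrow> ('p, 'n, 'z) preadditive_category_scheme \<Rightarrow>
   ('o, 'm, 'p, 'n) functor_data \<Rightarrow> ('o, 'm) complex_data \<Rightarrow> bool" where
  "F_split_acyclic A B F S \<longleftrightarrow> cochain_complex A S \<and> contractible B (map_complex F S)"

text \<open>The \<open>F\<close>-split acyclic complexes are the objects of the kernel of the functor induced by \<open>F\<close>
  on homotopy categories: being zero in the homotopy category of \<open>B\<close> means being contractible.\<close>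

definition D_F ::
  "('o, 'm, 'y) preadditive_category_scheme \<Rightarrow> ('p, 'n, 'z) preadditive_category_scheme \<Rightarrow>
   ('o, 'm, 'p, 'n) functor_data \<Rightarrow>
   (('o, 'm) complex_data,
    ('o, 'm) complex_data \<times> ('o, 'm) complex_data \<times>
      (('o, 'm) homotopy_arrow \<times> ('o, 'm) homotopy_arrow) set) category" where
  "D_F A B F = verdier_localization A {S. F_split_acyclic A B F S}"

definition F_projective_resolution ::
  "('o, 'm, 'y) preadditive_category_scheme \<Rightarrow> ('p, 'n, 'z) preadditive_category_scheme \<Rightarrow>
   ('o, 'm, 'p, 'n) functor_data \<Rightarrow> ('p, 'n, 'o, 'm) functor_data \<Rightarrow>
   ('o, 'm) complex_data \<Rightarrow> ('o, 'm) complex_data \<Rightarrow> (int \<Rightarrow> 'm) \<Rightarrow> bool" where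
  "F_projective_resolution A B F L X P p \<longleftrightarrow>
     cochain_complex A P \<and> (\<forall>n. F_projective A B L (Term P n)) \<and>
     p \<in> chain_maps A P X \<and> zero_object (D_F A B F) (cone A P X p)"

end

theory Submission
  imports Defs
begin

text \<open>
  The proof works with exactness relative to the class \<open>T\<close> of test objects \<open>L W\<close>, for \<open>W\<close> in \<open>\<B>\<close>: a complex
  \<open>S\<close> over \<open>\<A>\<close> is exact relative to \<open>T\<close> if all complexes \<open>Hom(L W, S)\<close> of abelian groups are exact.  By
  adjunction these are the complexes \<open>Hom(W, F S)\<close>, and a complex over \<open>\<B>\<close> is contractible if and only if it
  is exact under all functors \<open>Hom(W, -)\<close>.  Hence the \<open>F\<close>-split acyclic complexes are the ones that are
  exact relative to \<open>T\<close> (\<open>F_split_acyclic_iff\<close>).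

  Since \<open>X\<close> vanishes in high degrees, \<open>P\<close> and \<open>p\<close> can be built by downward recursion, starting from zero.
  Once \<open>P\<close> is known in degrees above \<open>n\<close>, so is the cone of \<open>p\<close> in degrees \<open>n\<close> and above.  Let \<open>Z\<close> be the
  kernel of its differential that leaves degree \<open>n\<close>, and let the next term be \<open>L (F Z)\<close>, mapped to \<open>Z\<close> by the
  counit.  Every arrow from some \<open>L W\<close> to \<open>Z\<close> factors through the counit, so the cone becomes exact relative
  to \<open>T\<close> in degree \<open>n\<close>.  The components of \<open>L (F Z) \<rightarrow> P (n + 1) \<oplus> X n\<close> are, up to sign, the differential
  and the augmentation (\<open>ex_resolution_step\<close>, \<open>ex_resolution\<close>).  All terms of \<open>P\<close> are zero or of the form \<open>L Y\<close>,
  and so they are \<open>F\<close>-projective.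

  It remains to see that a relatively exact complex \<open>S\<close> is a zero object of the localization
  (\<open>zero_object_verdier_localization\<close>).  Roofs out of \<open>S\<close> are refined by a roof with vertex \<open>0\<close>.  For roofs
  into \<open>S\<close> the key fact is that a chain map to a relatively exact complex becomes null homotopic on its
  desuspended cone, which projects to its source by a relative quasi-isomorphism
  (\<open>ex_quasi_iso_null_homotopic\<close>).  Applied to the cone of a left leg, this gives Ore squares; applied to
  \<open>S\<close>, it makes any two right legs agree.
\<close>

section \<open>Arrows with source and target\<close>

context category
begin

text \<open>Since an arrow determines its source and target, membership in a hom-set splits into three
  conditions on the arrow alone.  Typing side conditions can then be discharged by rewriting, and
  the laws of a preadditive category become conditional rewrite rules.  Source and target are
  meaningful for arrows only.\<close>

definition arr :: "'m \<Rightarrow> bool" where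
  "arr f \<longleftrightarrow> (\<exists>X Y. f \<in> Hom C X Y)"

definition src :: "'m \<Rightarrow> 'o" where
  "src f = (THE X. \<exists>Y. f \<in> Hom C X Y)"

definition tgt :: "'m \<Rightarrow> 'o" where
  "tgt f = (THE Y. \<exists>X. f \<in> Hom C X Y)"

lemma in_Hom_iff: "f \<in> Hom C X Y \<longleftrightarrow> arr f \<and> src f = X \<and> tgt f = Y"
proof -
  have *: "src f = X' \<and> tgt f = Y'" if "f \<in> Hom C X' Y'" for X' Y'
    unfolding src_def tgt_def using that Hom_disjoint by (blast intro: the_equality)
  show ?thesis
    using * unfolding arr_def by blast
qed

lemma src_in_Ob: "arr f \<Longrightarrow> src f \<in> Ob C" and tgt_in_Ob: "arr f \<Longrightarrow> tgt f \<in> Ob C"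
  using Hom_Ob in_Hom_iff by blast+

lemma arr_Comp [simp]: "arr f \<Longrightarrow> arr g \<Longrightarrow> tgt f = src g \<Longrightarrow> arr (g \<cdot> f)"
  and src_Comp [simp]: "arr f \<Longrightarrow> arr g \<Longrightarrow> tgt f = src g \<Longrightarrow> src (g \<cdot> f) = src f"
  and tgt_Comp [simp]: "arr f \<Longrightarrow> arr g \<Longrightarrow> tgt f = src g \<Longrightarrow> tgt (g \<cdot> f) = tgt g"
  using Comp_in[of f "src f" "src g" g "tgt g"] by (auto simp: in_Hom_iff)

lemma arr_Id [simp]: "X \<in> Ob C \<Longrightarrow> arr (Id C X)"
  and src_Id [simp]: "X \<in> Ob C \<Longrightarrow> src (Id C X) = X"
  and tgt_Id [simp]: "X \<in> Ob C \<Longrightarrow> tgt (Id C X) = X"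
  using Id_in[of X] by (auto simp: in_Hom_iff)

lemma Id_left [simp]: "arr f \<Longrightarrow> tgt f = Y \<Longrightarrow> Id C Y \<cdot> f = f"
  and Id_right [simp]: "arr f \<Longrightarrow> src f = X \<Longrightarrow> f \<cdot> Id C X = f"
  using Id_Comp[of f "src f" Y] Comp_Id[of f X "tgt f"] by (auto simp: in_Hom_iff)

lemma Comp_reassoc [simp]:
  "arr f \<Longrightarrow> arr g \<Longrightarrow> arr h \<Longrightarrow> tgt f = src g \<Longrightarrow> tgt g = src h \<Longrightarrow> (h \<cdot> g) \<cdot> f = h \<cdot> (g \<cdot> f)"
  using Comp_assoc[of f "src f" "src g" g "src h" h "tgt h"] by (auto simp: in_Hom_iff)

end

section \<open>Arithmetic of arrows\<close>

context preadditive_category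
begin

lemma hom_group_select [simp]:
  "carrier (hom_group C X Y) = Hom C X Y"
  "mult (hom_group C X Y) = Add C"
  "one (hom_group C X Y) = Zero C X Y"
  by (simp_all add: hom_group_def)

lemma hom_group: "X \<in> Ob C \<Longrightarrow> Y \<in> Ob C \<Longrightarrow> group (hom_group C X Y)"
  using hom_comm_group comm_group.axioms(2) by blast

lemma arr_hom_comm_group: "arr f \<Longrightarrow> comm_group (hom_group C (src f) (tgt f))"
  by (simp add: hom_comm_group src_in_Ob tgt_in_Ob)

lemma arr_hom_group: "arr f \<Longrightarrow> group (hom_group C (src f) (tgt f))"
  by (simp add: hom_group src_in_Ob tgt_in_Ob)

lemma arr_Zero [simp]: "X \<in> Ob C \<Longrightarrow> Y \<in> Ob C \<Longrightarrow> arr (Zero C X Y)"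
  and src_Zero [simp]: "X \<in> Ob C \<Longrightarrow> Y \<in> Ob C \<Longrightarrow> src (Zero C X Y) = X"
  and tgt_Zero [simp]: "X \<in> Ob C \<Longrightarrow> Y \<in> Ob C \<Longrightarrow> tgt (Zero C X Y) = Y"
  using monoid.one_closed[OF group.is_monoid[OF hom_group], of X Y] by (auto simp: in_Hom_iff)

lemma arr_Add [simp]: "arr f \<Longrightarrow> arr g \<Longrightarrow> src f = src g \<Longrightarrow> tgt f = tgt g \<Longrightarrow> arr (f \<boxplus> g)"
  and src_Add [simp]: "arr f \<Longrightarrow> arr g \<Longrightarrow> src f = src g \<Longrightarrow> tgt f = tgt g \<Longrightarrow> src (f \<boxplus> g) = src g"
  and tgt_Add [simp]: "arr f \<Longrightarrow> arr g \<Longrightarrow> src f = src g \<Longrightarrow> tgt f = tgt g \<Longrightarrow> tgt (f \<boxplus> g) = tgt g"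
  using monoid.m_closed[OF group.is_monoid[OF arr_hom_group[of f]], of f g]
  by (auto simp: in_Hom_iff)

lemma arr_Neg [simp]: "arr f \<Longrightarrow> src f = X \<Longrightarrow> tgt f = Y \<Longrightarrow> arr (Neg C X Y f)"
  and src_Neg [simp]: "arr f \<Longrightarrow> src f = X \<Longrightarrow> tgt f = Y \<Longrightarrow> src (Neg C X Y f) = X"
  and tgt_Neg [simp]: "arr f \<Longrightarrow> src f = X \<Longrightarrow> tgt f = Y \<Longrightarrow> tgt (Neg C X Y f) = Y"
  using group.inv_closed[OF arr_hom_group[of f], of f] by (auto simp: in_Hom_iff)

lemma Add_assoc: "arr f \<Longrightarrow> arr g \<Longrightarrow> arr h \<Longrightarrow> src f = src g \<Longrightarrow> tgt f = tgt g \<Longrightarrow>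
    src g = src h \<Longrightarrow> tgt g = tgt h \<Longrightarrow> (f \<boxplus> g) \<boxplus> h = f \<boxplus> (g \<boxplus> h)"
  using monoid.m_assoc[OF group.is_monoid[OF arr_hom_group[of f]], of f g h]
  by (auto simp: in_Hom_iff)

lemma Add_commute: "arr f \<Longrightarrow> arr g \<Longrightarrow> src f = src g \<Longrightarrow> tgt f = tgt g \<Longrightarrow> f \<boxplus> g = g \<boxplus> f"
  using comm_monoid.m_comm[OF comm_group.axioms(1)[OF arr_hom_comm_group[of f]], of f g]
  by (auto simp: in_Hom_iff)

lemma Add_left_commute: "arr f \<Longrightarrow> arr g \<Longrightarrow> arr h \<Longrightarrow> src f = src g \<Longrightarrow> tgt f = tgt g \<Longrightarrow>
    src g = src h \<Longrightarrow> tgt g = tgt h \<Longrightarrow> f \<boxplus> (g \<boxplus> h) = g \<boxplus> (f \<boxplus> h)"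
  using Add_assoc[of f g h] Add_assoc[of g f h] Add_commute[of f g] by simp

lemmas Add_ac = Add_assoc Add_commute Add_left_commute

lemma Add_Zero [simp]: "arr f \<Longrightarrow> src f = X \<Longrightarrow> tgt f = Y \<Longrightarrow> f \<boxplus> Zero C X Y = f"
  and Zero_Add [simp]: "arr f \<Longrightarrow> src f = X \<Longrightarrow> tgt f = Y \<Longrightarrow> Zero C X Y \<boxplus> f = f"
  using monoid.r_one[OF group.is_monoid[OF arr_hom_group[of f]], of f]
    monoid.l_one[OF group.is_monoid[OF arr_hom_group[of f]], of f]
  by (auto simp: in_Hom_iff)

lemma Add_Neg [simp]: "arr f \<Longrightarrow> src f = X \<Longrightarrow> tgt f = Y \<Longrightarrow> f \<boxplus> Neg C X Y f = Zero C X Y"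
  and Neg_Add [simp]: "arr f \<Longrightarrow> src f = X \<Longrightarrow> tgt f = Y \<Longrightarrow> Neg C X Y f \<boxplus> f = Zero C X Y"
  using group.r_inv[OF arr_hom_group[of f], of f] group.l_inv[OF arr_hom_group[of f], of f]
  by (auto simp: in_Hom_iff)

lemma Neg_Neg [simp]: "arr f \<Longrightarrow> src f = X \<Longrightarrow> tgt f = Y \<Longrightarrow> Neg C X Y (Neg C X Y f) = f"
  using group.inv_inv[OF arr_hom_group[of f], of f] by (auto simp: in_Hom_iff)

lemma Neg_Zero [simp]: "X \<in> Ob C \<Longrightarrow> Y \<in> Ob C \<Longrightarrow> Neg C X Y (Zero C X Y) = Zero C X Y"
  using monoid.inv_one[OF group.is_monoid[OF hom_group[of X Y]]] by simp

lemma Neg_of_Add [simp]: "arr f \<Longrightarrow> arr g \<Longrightarrow> src f = X \<Longrightarrow> src g = X \<Longrightarrow> tgt f = Y \<Longrightarrow> tgt g = Y \<Longrightarrow>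
    Neg C X Y (f \<boxplus> g) = Neg C X Y f \<boxplus> Neg C X Y g"
  using comm_group.inv_mult[OF arr_hom_comm_group[of f], of f g] by (auto simp: in_Hom_iff)

lemma Neg_unique:
  "arr f \<Longrightarrow> arr g \<Longrightarrow> src f = X \<Longrightarrow> src g = X \<Longrightarrow> tgt f = Y \<Longrightarrow> tgt g = Y \<Longrightarrow>
    f \<boxplus> g = Zero C X Y \<Longrightarrow> g = Neg C X Y f"
  using group.inv_equality[OF arr_hom_group[of f], of g f] Add_commute[of f g]
  by (auto simp: in_Hom_iff)

lemma Add_eq_Zero_imp:
  "arr f \<Longrightarrow> arr g \<Longrightarrow> src f = X \<Longrightarrow> src g = X \<Longrightarrow> tgt f = Y \<Longrightarrow> tgt g = Y \<Longrightarrow>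
    f \<boxplus> g = Zero C X Y \<Longrightarrow> f = Neg C X Y g"
  using Neg_unique[of g f X Y] Add_commute[of f g] by simp

lemma Add_Neg_cancel [simp]:
  "arr f \<Longrightarrow> arr g \<Longrightarrow> src f = X \<Longrightarrow> src g = X \<Longrightarrow> tgt f = Y \<Longrightarrow> tgt g = Y \<Longrightarrow>
    f \<boxplus> (Neg C X Y f \<boxplus> g) = g"
  "arr f \<Longrightarrow> arr g \<Longrightarrow> src f = X \<Longrightarrow> src g = X \<Longrightarrow> tgt f = Y \<Longrightarrow> tgt g = Y \<Longrightarrow>
    Neg C X Y f \<boxplus> (f \<boxplus> g) = g"
  by (simp_all flip: Add_assoc)

lemma Comp_Add_distrib [simp]: "arr f \<Longrightarrow> arr f' \<Longrightarrow> arr g \<Longrightarrow> src f = src f' \<Longrightarrow> tgt f = tgt f' \<Longrightarrow>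
    tgt f' = src g \<Longrightarrow> g \<cdot> (f \<boxplus> f') = g \<cdot> f \<boxplus> g \<cdot> f'"
  using Comp_Add[of f "src f" "tgt f" f' g "tgt g"] by (auto simp: in_Hom_iff)

lemma Add_Comp_distrib [simp]: "arr f \<Longrightarrow> arr g' \<Longrightarrow> arr g \<Longrightarrow> src g = src g' \<Longrightarrow> tgt g = tgt g' \<Longrightarrow>
    tgt f = src g' \<Longrightarrow> (g \<boxplus> g') \<cdot> f = g \<cdot> f \<boxplus> g' \<cdot> f"
  using Add_Comp[of f "src f" "tgt f" g "tgt g" g'] by (auto simp: in_Hom_iff)

lemma idem_Zero:
  assumes "arr f" "f \<boxplus> f = f" shows "f = Zero C (src f) (tgt f)"
proof -
  have "Neg C (src f) (tgt f) f \<boxplus> (f \<boxplus> f) = f"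
    using assms(1) by simp
  then show ?thesis
    using assms by simp
qed

lemma Comp_Zero [simp]:
  assumes "arr g" "src g = Y" "X \<in> Ob C" shows "g \<cdot> Zero C X Y = Zero C X (tgt g)"
proof -
  have Y: "Y \<in> Ob C" using assms src_in_Ob by blast
  have "g \<cdot> Zero C X Y \<boxplus> g \<cdot> Zero C X Y = g \<cdot> (Zero C X Y \<boxplus> Zero C X Y)"
    using assms Y by (simp del: Add_Zero Zero_Add)
  then show ?thesis
    using idem_Zero[of "g \<cdot> Zero C X Y"] assms Y by simp
qed

lemma Zero_Comp [simp]:
  assumes "arr f" "tgt f = Y" "Z \<in> Ob C" shows "Zero C Y Z \<cdot> f = Zero C (src f) Z"
proof -
  have Y: "Y \<in> Ob C" using assms tgt_in_Ob by blast
  have "Zero C Y Z \<cdot> f \<boxplus> Zero C Y Z \<cdot> f = (Zero C Y Z \<boxplus> Zero C Y Z) \<cdot> f"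
    using assms Y by (simp del: Add_Zero Zero_Add)
  then show ?thesis
    using idem_Zero[of "Zero C Y Z \<cdot> f"] assms Y by simp
qed

lemma Comp_Neg [simp]:
  assumes "arr f" "arr g" "src f = X" "tgt f = Y" "src g = Y"
  shows "g \<cdot> Neg C X Y f = Neg C X (tgt g) (g \<cdot> f)"
proof (rule Neg_unique)
  have "g \<cdot> f \<boxplus> g \<cdot> Neg C X Y f = g \<cdot> (f \<boxplus> Neg C X Y f)"
    using assms by (simp del: Add_Neg)
  then show "g \<cdot> f \<boxplus> g \<cdot> Neg C X Y f = Zero C X (tgt g)"
    using assms src_in_Ob by auto
qed (use assms in auto)

lemma Neg_Comp [simp]:
  assumes "arr f" "arr g" "src g = X" "tgt g = Y" "tgt f = X"
  shows "Neg C X Y g \<cdot> f = Neg C (src f) Y (g \<cdot> f)"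
proof (rule Neg_unique)
  have "g \<cdot> f \<boxplus> Neg C X Y g \<cdot> f = (g \<boxplus> Neg C X Y g) \<cdot> f"
    using assms by (simp del: Add_Neg)
  then show "g \<cdot> f \<boxplus> Neg C X Y g \<cdot> f = Zero C (src f) Y"
    using assms tgt_in_Ob by auto
qed (use assms in auto)

lemma zero_object_target:
  "zero_object C Z \<Longrightarrow> arr f \<Longrightarrow> tgt f = Z \<Longrightarrow> f = Zero C (src f) Z"
  unfolding zero_object_def using src_in_Ob[of f] arr_Zero[of "src f" Z]
  by (metis in_Hom_iff src_Zero tgt_Zero)

lemma zero_object_Ob: "zero_object C Z \<Longrightarrow> Z \<in> Ob C"
  by (simp add: zero_object_def)

end

section \<open>Biproducts\<close>

context abelian_category
begin

lemma is_biproduct_biprod: "X \<in> Ob C \<Longrightarrow> Y \<in> Ob C \<Longrightarrow> is_biproduct C X Y (biprod C X Y)"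
  unfolding biprod_def using ex_biproduct someI_ex[of "is_biproduct C X Y"] by blast

lemma biprod_typing [simp]:
  assumes "X \<in> Ob C" "Y \<in> Ob C"
  shows "arr (in1 (biprod C X Y))" "src (in1 (biprod C X Y)) = X" "tgt (in1 (biprod C X Y)) = vertex (biprod C X Y)"
    "arr (in2 (biprod C X Y))" "src (in2 (biprod C X Y)) = Y" "tgt (in2 (biprod C X Y)) = vertex (biprod C X Y)"
    "arr (pr1 (biprod C X Y))" "src (pr1 (biprod C X Y)) = vertex (biprod C X Y)" "tgt (pr1 (biprod C X Y)) = X"
    "arr (pr2 (biprod C X Y))" "src (pr2 (biprod C X Y)) = vertex (biprod C X Y)" "tgt (pr2 (biprod C X Y)) = Y"
    "vertex (biprod C X Y) \<in> Ob C"
  using is_biproduct_biprod[OF assms] tgt_in_Ob[of "in1 (biprod C X Y)"] unfolding is_biproduct_def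
  by (auto simp: in_Hom_iff)

lemma biprod_simps [simp]:
  assumes "X \<in> Ob C" "Y \<in> Ob C"
  shows "pr1 (biprod C X Y) \<cdot> in1 (biprod C X Y) = Id C X"
    "pr2 (biprod C X Y) \<cdot> in2 (biprod C X Y) = Id C Y"
    "pr1 (biprod C X Y) \<cdot> in2 (biprod C X Y) = Zero C Y X"
    "pr2 (biprod C X Y) \<cdot> in1 (biprod C X Y) = Zero C X Y"
    "in1 (biprod C X Y) \<cdot> pr1 (biprod C X Y) \<boxplus> in2 (biprod C X Y) \<cdot> pr2 (biprod C X Y) = Id C (vertex (biprod C X Y))"
  using is_biproduct_biprod[OF assms] unfolding is_biproduct_def by auto

lemma biprod_simps_Comp [simp]:
  assumes "X \<in> Ob C" "Y \<in> Ob C" "arr f"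
  shows "tgt f = X \<Longrightarrow> pr1 (biprod C X Y) \<cdot> (in1 (biprod C X Y) \<cdot> f) = f"
    "tgt f = Y \<Longrightarrow> pr2 (biprod C X Y) \<cdot> (in2 (biprod C X Y) \<cdot> f) = f"
    "tgt f = Y \<Longrightarrow> pr1 (biprod C X Y) \<cdot> (in2 (biprod C X Y) \<cdot> f) = Zero C (src f) X"
    "tgt f = X \<Longrightarrow> pr2 (biprod C X Y) \<cdot> (in1 (biprod C X Y) \<cdot> f) = Zero C (src f) Y"
  using assms by (simp_all flip: Comp_reassoc)

lemma biprod_eqI:
  assumes "X \<in> Ob C" "Y \<in> Ob C" "arr f" "arr g" "tgt f = vertex (biprod C X Y)"
    "tgt g = vertex (biprod C X Y)"
    "pr1 (biprod C X Y) \<cdot> f = pr1 (biprod C X Y) \<cdot> g" "pr2 (biprod C X Y) \<cdot> f = pr2 (biprod C X Y) \<cdot> g"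
  shows "f = g"
proof -
  have *: "k = in1 (biprod C X Y) \<cdot> (pr1 (biprod C X Y) \<cdot> k) \<boxplus> in2 (biprod C X Y) \<cdot> (pr2 (biprod C X Y) \<cdot> k)"
    if "arr k" "tgt k = vertex (biprod C X Y)" for k
  proof -
    have "k = (in1 (biprod C X Y) \<cdot> pr1 (biprod C X Y) \<boxplus> in2 (biprod C X Y) \<cdot> pr2 (biprod C X Y)) \<cdot> k"
      using assms(1,2) that by (simp del: Add_Comp_distrib)
    also have "\<dots> = in1 (biprod C X Y) \<cdot> (pr1 (biprod C X Y) \<cdot> k) \<boxplus> in2 (biprod C X Y) \<cdot> (pr2 (biprod C X Y) \<cdot> k)"
      using assms(1,2) that by (simp del: biprod_simps)
    finally show ?thesis .
  qed
  show ?thesis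
    using *[of f] *[of g] assms by simp
qed

end

section \<open>Complexes, chain maps and homotopies\<close>

text \<open>Normal forms for the indices that occur below.\<close>

lemma int_index_simps [simp]:
  "(n::int) + 1 + 1 = n + 2" "n + 2 + 1 = n + 3" "n + 2 - 1 = n + 1" "n + 3 - 1 = n + 2"
  "n - 1 + 2 = n + 1"
  by simp_all

context preadditive_category
begin

lemma complex_typing [simp]:
  assumes "cochain_complex C X"
  shows "Term X n \<in> Ob C" "arr (Diff X n)" "src (Diff X n) = Term X n" "tgt (Diff X n) = Term X (n + 1)"
  using assms unfolding cochain_complex_def by (auto simp: in_Hom_iff)

text \<open>The two indices are linked by an equation, so that the rule also rewrites consecutive indices
  such as \<open>n\<close> and \<open>n - 1\<close>.\<close>

lemma Diff_Diff [simp]: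
  assumes "cochain_complex C X" "m = n + 1"
  shows "Diff X m \<cdot> Diff X n = Zero C (Term X n) (Term X (m + 1))"
  using assms unfolding cochain_complex_def by simp

lemma Diff_Diff_Comp [simp]:
  assumes "cochain_complex C X" "m = n + 1" "arr f" "tgt f = Term X n"
  shows "Diff X m \<cdot> (Diff X n \<cdot> f) = Zero C (src f) (Term X (m + 1))"
proof -
  have "Diff X m \<cdot> (Diff X n \<cdot> f) = (Diff X m \<cdot> Diff X n) \<cdot> f"
    using assms by (simp del: Diff_Diff)
  then show ?thesis
    using assms by simp
qed

lemma cochain_complexI:
  assumes "\<And>n. Term X n \<in> Ob C" "\<And>n. Diff X n \<in> Hom C (Term X n) (Term X (n + 1))"
    "\<And>n. Diff X (n + 1) \<cdot> Diff X n = Zero C (Term X n) (Term X (n + 2))"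
  shows "cochain_complex C X"
  using assms unfolding cochain_complex_def by blast

lemma chain_maps_typing:
  assumes "f \<in> chain_maps C X Y"
  shows "arr (f n)" "src (f n) = Term X n" "tgt (f n) = Term Y n" "cochain_complex C X" "cochain_complex C Y"
  using assms unfolding chain_maps_def by (auto simp: in_Hom_iff)

lemma chain_maps_Diff:
  assumes "f \<in> chain_maps C X Y"
  shows "Diff Y n \<cdot> f n = f (n + 1) \<cdot> Diff X n"
  using assms unfolding chain_maps_def by auto

lemma chain_maps_Diff_Comp:
  assumes "f \<in> chain_maps C X Y" "arr g" "tgt g = Term X n"
  shows "Diff Y n \<cdot> (f n \<cdot> g) = f (n + 1) \<cdot> (Diff X n \<cdot> g)"
proof -
  note [simp] = chain_maps_typing[OF assms(1)]
  have "Diff Y n \<cdot> (f n \<cdot> g) = (Diff Y n \<cdot> f n) \<cdot> g"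
    using assms(2,3) by simp
  then show ?thesis
    using assms(2,3) by (simp add: chain_maps_Diff[OF assms(1)])
qed

lemmas chain_maps_simps = chain_maps_typing chain_maps_Diff chain_maps_Diff_Comp

lemma chain_mapsI:
  assumes "cochain_complex C X" "cochain_complex C Y"
    "\<And>n. f n \<in> Hom C (Term X n) (Term Y n)" "\<And>n. Diff Y n \<cdot> f n = f (n + 1) \<cdot> Diff X n"
  shows "f \<in> chain_maps C X Y"
  using assms unfolding chain_maps_def by auto

lemma chain_maps_Id: "cochain_complex C X \<Longrightarrow> (\<lambda>n. Id C (Term X n)) \<in> chain_maps C X X"
  by (intro chain_mapsI) (auto simp: in_Hom_iff)

lemma chain_maps_Zero: "cochain_complex C X \<Longrightarrow> cochain_complex C Y \<Longrightarrow>
    (\<lambda>n. Zero C (Term X n) (Term Y n)) \<in> chain_maps C X Y"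
  by (intro chain_mapsI) (auto simp: in_Hom_iff)

lemma chain_maps_Comp:
  assumes "f \<in> chain_maps C X Y" "g \<in> chain_maps C Y Z"
  shows "(\<lambda>n. g n \<cdot> f n) \<in> chain_maps C X Z"
proof -
  note [simp] = chain_maps_simps[OF assms(1)] chain_maps_simps[OF assms(2)]
  show ?thesis
    by (intro chain_mapsI) (auto simp: in_Hom_iff)
qed

lemma homotopy_relI:
  assumes "f \<in> chain_maps C X Y" "g \<in> chain_maps C X Y"
    "\<And>n. h n \<in> Hom C (Term X n) (Term Y (n - 1))"
    "\<And>n. g n = f n \<boxplus> (Diff Y (n - 1) \<cdot> h n \<boxplus> h (n + 1) \<cdot> Diff X n)"
  shows "(f, g) \<in> homotopy_rel C X Y"
  using assms unfolding homotopy_rel_def by blast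

lemma homotopy_relE:
  assumes "(f, g) \<in> homotopy_rel C X Y"
  obtains h where "f \<in> chain_maps C X Y" "g \<in> chain_maps C X Y"
    "\<And>n. arr (h n)" "\<And>n. src (h n) = Term X n" "\<And>n. tgt (h n) = Term Y (n - 1)"
    "\<And>n. g n = f n \<boxplus> (Diff Y (n - 1) \<cdot> h n \<boxplus> h (n + 1) \<cdot> Diff X n)"
  using assms unfolding homotopy_rel_def in_Hom_iff by blast

lemma homotopy_rel_refl: "f \<in> chain_maps C X Y \<Longrightarrow> (f, f) \<in> homotopy_rel C X Y"
  by (rule homotopy_relI[where h = "\<lambda>n. Zero C (Term X n) (Term Y (n - 1))"])
    (auto simp: chain_maps_simps in_Hom_iff)

lemma homotopy_rel_sym:
  assumes "(f, g) \<in> homotopy_rel C X Y"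
  shows "(g, f) \<in> homotopy_rel C X Y"
  using assms
proof (rule homotopy_relE)
  fix h
  assume fg: "f \<in> chain_maps C X Y" "g \<in> chain_maps C X Y"
    and [simp]: "\<And>n. arr (h n)" "\<And>n. src (h n) = Term X n" "\<And>n. tgt (h n) = Term Y (n - 1)"
    and g: "\<And>n. g n = f n \<boxplus> (Diff Y (n - 1) \<cdot> h n \<boxplus> h (n + 1) \<cdot> Diff X n)"
  note [simp] = chain_maps_typing[OF fg(1)]
  show ?thesis
    by (rule homotopy_relI[OF fg(2,1), where h = "\<lambda>n. Neg C (Term X n) (Term Y (n - 1)) (h n)"])
      (auto simp: in_Hom_iff g Add_assoc simp flip: Neg_of_Add)
qed

lemma homotopy_rel_trans:
  assumes "(f, g) \<in> homotopy_rel C X Y" "(g, k) \<in> homotopy_rel C X Y"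
  shows "(f, k) \<in> homotopy_rel C X Y"
  using assms(1)
proof (rule homotopy_relE)
  fix h
  assume fg: "f \<in> chain_maps C X Y" "g \<in> chain_maps C X Y"
    and [simp]: "\<And>n. arr (h n)" "\<And>n. src (h n) = Term X n" "\<And>n. tgt (h n) = Term Y (n - 1)"
    and g: "\<And>n. g n = f n \<boxplus> (Diff Y (n - 1) \<cdot> h n \<boxplus> h (n + 1) \<cdot> Diff X n)"
  note [simp] = chain_maps_typing[OF fg(1)]
  from assms(2) show ?thesis
  proof (rule homotopy_relE)
    fix h'
    assume gk: "k \<in> chain_maps C X Y"
      and [simp]: "\<And>n. arr (h' n)" "\<And>n. src (h' n) = Term X n" "\<And>n. tgt (h' n) = Term Y (n - 1)"
      and k: "\<And>n. k n = g n \<boxplus> (Diff Y (n - 1) \<cdot> h' n \<boxplus> h' (n + 1) \<cdot> Diff X n)"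
    show ?thesis
      by (rule homotopy_relI[OF fg(1) gk, where h = "\<lambda>n. h n \<boxplus> h' n"])
        (auto simp: in_Hom_iff g k Add_ac)
  qed
qed

lemma homotopy_rel_Comp_left:
  assumes "(f, g) \<in> homotopy_rel C X Y" "k \<in> chain_maps C Y Z"
  shows "(\<lambda>n. k n \<cdot> f n, \<lambda>n. k n \<cdot> g n) \<in> homotopy_rel C X Z"
  using assms(1)
proof (rule homotopy_relE)
  fix h
  assume fg: "f \<in> chain_maps C X Y" "g \<in> chain_maps C X Y"
    and [simp]: "\<And>n. arr (h n)" "\<And>n. src (h n) = Term X n" "\<And>n. tgt (h n) = Term Y (n - 1)"
    and g: "\<And>n. g n = f n \<boxplus> (Diff Y (n - 1) \<cdot> h n \<boxplus> h (n + 1) \<cdot> Diff X n)"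
  note [simp] = chain_maps_typing[OF fg(1)] chain_maps_simps[OF assms(2)]
  show ?thesis
    by (rule homotopy_relI[OF fg[THEN chain_maps_Comp, OF assms(2)], where h = "\<lambda>n. k (n - 1) \<cdot> h n"])
      (auto simp: in_Hom_iff g)
qed

lemma homotopy_rel_Comp_right:
  assumes "(f, g) \<in> homotopy_rel C Y Z" "k \<in> chain_maps C X Y"
  shows "(\<lambda>n. f n \<cdot> k n, \<lambda>n. g n \<cdot> k n) \<in> homotopy_rel C X Z"
  using assms(1)
proof (rule homotopy_relE)
  fix h
  assume fg: "f \<in> chain_maps C Y Z" "g \<in> chain_maps C Y Z"
    and [simp]: "\<And>n. arr (h n)" "\<And>n. src (h n) = Term Y n" "\<And>n. tgt (h n) = Term Z (n - 1)"
    and g: "\<And>n. g n = f n \<boxplus> (Diff Z (n - 1) \<cdot> h n \<boxplus> h (n + 1) \<cdot> Diff Y n)"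
  note [simp] = chain_maps_typing[OF fg(1)] chain_maps_simps[OF assms(2)]
  show ?thesis
    by (rule homotopy_relI[OF fg[THEN chain_maps_Comp[OF assms(2)]], where h = "\<lambda>n. h n \<cdot> k n"])
      (auto simp: in_Hom_iff g)
qed

lemma equiv_homotopy_rel: "equiv (chain_maps C X Y) (homotopy_rel C X Y)"
proof (rule equivI)
  show "homotopy_rel C X Y \<subseteq> chain_maps C X Y \<times> chain_maps C X Y"
    by (auto simp: homotopy_rel_def)
qed (auto intro!: refl_onI symI transI homotopy_rel_refl intro: homotopy_rel_sym homotopy_rel_trans)

end

section \<open>The homotopy category\<close>

context preadditive_category
begin

text \<open>The arrow of the homotopy category represented by a chain map, tagged with its source and
  target.\<close>

definition homotopy_class ::
  "('o, 'm) complex_data \<Rightarrow> ('o, 'm) complex_data \<Rightarrow> (int \<Rightarrow> 'm) \<Rightarrow> ('o, 'm) homotopy_arrow" where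
  "homotopy_class X Y f = (X, Y, homotopy_rel C X Y `` {f})"

lemma Ob_homotopy_category: "Ob (homotopy_category C) = {X. cochain_complex C X}"
  by (simp add: homotopy_category_def)

lemma Hom_homotopy_category: "Hom (homotopy_category C) X Y = homotopy_class X Y ` chain_maps C X Y"
  by (auto simp: homotopy_category_def homotopy_class_def quotient_def)

lemma homotopy_class_eqI: "(f, g) \<in> homotopy_rel C X Y \<Longrightarrow> homotopy_class X Y f = homotopy_class X Y g"
  unfolding homotopy_class_def using equiv_class_eq[OF equiv_homotopy_rel] by blast

lemma Comp_homotopy_class:
  assumes f: "f \<in> chain_maps C X Y" and g: "g \<in> chain_maps C Y Z"
  shows "homotopy_class Y Z g \<cdot>\<^bsub>homotopy_category C\<^esub> homotopy_class X Y f = homotopy_class X Z (\<lambda>n. g n \<cdot> f n)"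
proof -
  have "(\<lambda>n. g n \<cdot> f n, \<lambda>n. g' n \<cdot> f' n) \<in> homotopy_rel C X Z"
    if "(f, f') \<in> homotopy_rel C X Y" "(g, g') \<in> homotopy_rel C Y Z" for f' g'
  proof -
    have "f' \<in> chain_maps C X Y"
      using that by (auto simp: homotopy_rel_def)
    then show ?thesis
      using homotopy_rel_trans homotopy_rel_Comp_left[OF that(1) g] homotopy_rel_Comp_right[OF that(2)]
      by blast
  qed
  then have "homotopy_rel C X Z `` {\<lambda>n. g' n \<cdot> f' n |g' f'. (g, g') \<in> homotopy_rel C Y Z \<and> (f, f') \<in> homotopy_rel C X Y}
    = homotopy_rel C X Z `` {\<lambda>n. g n \<cdot> f n}"
    using homotopy_rel_refl[OF f] homotopy_rel_refl[OF g]
    by (auto intro: homotopy_rel_trans)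
  then show ?thesis
    by (simp add: homotopy_category_def homotopy_class_def)
qed

end

section \<open>Mapping cones\<close>

context abelian_category
begin

text \<open>The biproduct underlying the \<open>n\<close>-th term of the cone of a chain map \<open>X \<rightarrow> Y\<close>.\<close>

abbreviation cone_summands ::
  "('o, 'm) complex_data \<Rightarrow> ('o, 'm) complex_data \<Rightarrow> int \<Rightarrow> ('o, 'm) biproduct" where
  "cone_summands X Y n \<equiv> biprod C (Term X (n + 1)) (Term Y n)"

lemma Term_cone [simp]: "Term (cone C X Y f) n = vertex (cone_summands X Y n)"
  by (simp add: cone_def Let_def)

lemma cone_Diff_typing:
  assumes "f \<in> chain_maps C X Y"
  shows "arr (Diff (cone C X Y f) n)" "src (Diff (cone C X Y f) n) = vertex (cone_summands X Y n)"
    "tgt (Diff (cone C X Y f) n) = vertex (cone_summands X Y (n + 1))"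
  using chain_maps_typing[OF assms] by (auto simp: cone_def)

text \<open>In terms of components, the differential of the cone is \<open>(x, y) \<mapsto> (- d x, f x + d y)\<close>.\<close>

lemma pr_cone_Diff:
  assumes "f \<in> chain_maps C X Y" "m = n + 1" "k = m + 1"
  shows "pr1 (biprod C (Term X k) (Term Y m)) \<cdot> Diff (cone C X Y f) n
      = Neg C (vertex (cone_summands X Y n)) (Term X k) (Diff X m \<cdot> pr1 (cone_summands X Y n))"
    "pr2 (biprod C (Term X k) (Term Y m)) \<cdot> Diff (cone C X Y f) n
      = f m \<cdot> pr1 (cone_summands X Y n) \<boxplus> Diff Y n \<cdot> pr2 (cone_summands X Y n)"
  using chain_maps_typing[OF assms(1)] assms(2,3) by (auto simp: cone_def simp del: biprod_simps(5))

lemma pr_cone_Diff_Comp: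
  assumes f: "f \<in> chain_maps C X Y" and [simp]: "m = n + 1" "k = m + 1"
    and [simp]: "arr g" "tgt g = vertex (cone_summands X Y n)"
  shows "pr1 (biprod C (Term X k) (Term Y m)) \<cdot> (Diff (cone C X Y f) n \<cdot> g)
      = Neg C (src g) (Term X k) (Diff X m \<cdot> (pr1 (cone_summands X Y n) \<cdot> g))" (is ?pr1)
    "pr2 (biprod C (Term X k) (Term Y m)) \<cdot> (Diff (cone C X Y f) n \<cdot> g)
      = f m \<cdot> (pr1 (cone_summands X Y n) \<cdot> g) \<boxplus> Diff Y n \<cdot> (pr2 (cone_summands X Y n) \<cdot> g)" (is ?pr2)
proof -
  note [simp] = chain_maps_typing[OF f] cone_Diff_typing[OF f]
  have *: "p \<cdot> (Diff (cone C X Y f) n \<cdot> g) = (p \<cdot> Diff (cone C X Y f) n) \<cdot> g"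
    if "arr p" "src p = vertex (biprod C (Term X k) (Term Y m))" for p
    using that by simp
  show ?pr1 ?pr2
    by (subst *; simp add: pr_cone_Diff[OF f])+
qed

lemmas cone_simps = chain_maps_typing cone_Diff_typing pr_cone_Diff pr_cone_Diff_Comp

lemma cochain_complex_cone:
  assumes f: "f \<in> chain_maps C X Y"
  shows "cochain_complex C (cone C X Y f)"
proof (rule cochain_complexI)
  note [simp] = cone_simps[OF f]
  fix n
  show "Term (cone C X Y f) n \<in> Ob C"
    "Diff (cone C X Y f) n \<in> Hom C (Term (cone C X Y f) n) (Term (cone C X Y f) (n + 1))"
    by (auto simp: in_Hom_iff)
  show "Diff (cone C X Y f) (n + 1) \<cdot> Diff (cone C X Y f) n =
         Zero C (Term (cone C X Y f) n) (Term (cone C X Y f) (n + 2))"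
    by (rule biprod_eqI[where X = "Term X (n + 2 + 1)" and Y = "Term Y (n + 2)"])
      (auto simp: chain_maps_Diff_Comp[OF f])
qed

end

section \<open>Exactness relative to test objects\<close>

context abelian_category
begin

text \<open>A complex is exact relative to a class \<open>T\<close> of test objects if \<open>Hom(t, -)\<close> maps it to an exact
  complex of abelian groups for every \<open>t\<close> in \<open>T\<close>.  Exactness is stated at index \<open>n + 1\<close>, which
  covers all integers.\<close>

definition exact_on :: "'o set \<Rightarrow> ('o, 'm) complex_data \<Rightarrow> bool" where
  "exact_on T S \<longleftrightarrow> (\<forall>t \<in> T. \<forall>n. \<forall>g \<in> Hom C t (Term S (n + 1)).
     Diff S (n + 1) \<cdot> g = Zero C t (Term S (n + 2)) \<longrightarrow>
     (\<exists>h \<in> Hom C t (Term S n). Diff S n \<cdot> h = g))"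

text \<open>A chain map is a quasi-isomorphism relative to \<open>T\<close> if its cone is exact relative to \<open>T\<close>.  The
  definition unfolds this into components: a cocycle \<open>(x, y)\<close> of the cone, \<open>d x = 0\<close> and
  \<open>f x + d y = 0\<close>, is the coboundary of \<open>(- x', y')\<close>, that is, \<open>d x' = x\<close> and
  \<open>y + f x' = d y'\<close>.  The sign of \<open>x'\<close> is chosen so that no negation remains.\<close>

definition quasi_iso_on ::
  "'o set \<Rightarrow> ('o, 'm) complex_data \<Rightarrow> ('o, 'm) complex_data \<Rightarrow> (int \<Rightarrow> 'm) \<Rightarrow> bool" where
  "quasi_iso_on T X Y f \<longleftrightarrow> f \<in> chain_maps C X Y \<and> (\<forall>n x y. arr x \<and> arr y \<and> src x \<in> T \<and> src y = src x \<and>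
     tgt x = Term X (n + 2) \<and> tgt y = Term Y (n + 1) \<and>
     Diff X (n + 2) \<cdot> x = Zero C (src x) (Term X (n + 3)) \<and>
     f (n + 2) \<cdot> x \<boxplus> Diff Y (n + 1) \<cdot> y = Zero C (src x) (Term Y (n + 2)) \<longrightarrow>
     (\<exists>x' y'. arr x' \<and> arr y' \<and> src x' = src x \<and> src y' = src x \<and>
        tgt x' = Term X (n + 1) \<and> tgt y' = Term Y n \<and>
        Diff X (n + 1) \<cdot> x' = x \<and> y \<boxplus> f (n + 1) \<cdot> x' = Diff Y n \<cdot> y'))"

lemma quasi_iso_onD:
  assumes "quasi_iso_on T X Y f" "arr x" "arr y" "src x \<in> T" "src y = src x"
     "tgt x = Term X (n + 2)" "tgt y = Term Y (n + 1)"
     "Diff X (n + 2) \<cdot> x = Zero C (src x) (Term X (n + 3))"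
     "f (n + 2) \<cdot> x \<boxplus> Diff Y (n + 1) \<cdot> y = Zero C (src x) (Term Y (n + 2))"
  obtains x' y' where "arr x'" "arr y'" "src x' = src x" "src y' = src x"
        "tgt x' = Term X (n + 1)" "tgt y' = Term Y n"
        "Diff X (n + 1) \<cdot> x' = x" "y \<boxplus> f (n + 1) \<cdot> x' = Diff Y n \<cdot> y'"
  using assms unfolding quasi_iso_on_def by blast

lemma quasi_iso_onI:
  assumes "f \<in> chain_maps C X Y"
    "\<And>n x y. arr x \<Longrightarrow> arr y \<Longrightarrow> src x \<in> T \<Longrightarrow> src y = src x \<Longrightarrow>
     tgt x = Term X (n + 2) \<Longrightarrow> tgt y = Term Y (n + 1) \<Longrightarrow>
     Diff X (n + 2) \<cdot> x = Zero C (src x) (Term X (n + 3)) \<Longrightarrow>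
     f (n + 2) \<cdot> x \<boxplus> Diff Y (n + 1) \<cdot> y = Zero C (src x) (Term Y (n + 2)) \<Longrightarrow>
     \<exists>x' y'. arr x' \<and> arr y' \<and> src x' = src x \<and> src y' = src x \<and>
        tgt x' = Term X (n + 1) \<and> tgt y' = Term Y n \<and>
        Diff X (n + 1) \<cdot> x' = x \<and> y \<boxplus> f (n + 1) \<cdot> x' = Diff Y n \<cdot> y'"
  shows "quasi_iso_on T X Y f"
  using assms unfolding quasi_iso_on_def by blast

lemma exact_onD:
  assumes "exact_on T S" "arr g" "src g \<in> T" "tgt g = Term S (n + 1)"
    "Diff S (n + 1) \<cdot> g = Zero C (src g) (Term S (n + 2))"
  obtains h where "arr h" "src h = src g" "tgt h = Term S n" "Diff S n \<cdot> h = g"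
  using assms unfolding exact_on_def by (metis in_Hom_iff)

lemma exact_on_cone_iff:
  assumes f: "f \<in> chain_maps C X Y"
  shows "exact_on T (cone C X Y f) \<longleftrightarrow> quasi_iso_on T X Y f"
proof
  note [simp] = cone_simps[OF f]
  assume ex: "exact_on T (cone C X Y f)"
  show "quasi_iso_on T X Y f"
  proof (rule quasi_iso_onI[OF f])
    fix n x y
    assume xy [simp]: "arr x" "arr y" "src y = src x" "tgt x = Term X (n + 2)" "tgt y = Term Y (n + 1)"
      and t: "src x \<in> T"
      and dx [simp]: "Diff X (n + 2) \<cdot> x = Zero C (src x) (Term X (n + 3))"
      and dy [simp]: "f (n + 2) \<cdot> x \<boxplus> Diff Y (n + 1) \<cdot> y = Zero C (src x) (Term Y (n + 2))"
    let ?S = "cone_summands X Y (n + 1)"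
    define g where "g = in1 ?S \<cdot> x \<boxplus> in2 ?S \<cdot> y"
    have [simp]: "src x \<in> Ob C" using src_in_Ob by simp
    have [simp]: "arr g" "src g = src x" "tgt g = vertex ?S" by (simp_all add: g_def)
    have g1: "pr1 ?S \<cdot> g = x" and g2: "pr2 ?S \<cdot> g = y" by (simp_all add: g_def)
    have "Diff (cone C X Y f) (n + 1) \<cdot> g = Zero C (src x) (vertex (cone_summands X Y (n + 2)))"
      by (rule biprod_eqI[where X = "Term X (n + 2 + 1)" and Y = "Term Y (n + 2)"])
        (use g1 g2 in auto)
    then obtain h where [simp]: "arr h" "src h = src x" "tgt h = vertex (cone_summands X Y n)"
      and h: "Diff (cone C X Y f) n \<cdot> h = g"
      using exact_onD[OF ex, of g n] t by auto
    define x' where "x' = Neg C (src x) (Term X (n + 1)) (pr1 (cone_summands X Y n) \<cdot> h)"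
    define y' where "y' = pr2 (cone_summands X Y n) \<cdot> h"
    have x: "x = Diff X (n + 1) \<cdot> x'"
      using arg_cong[OF h, of "(\<cdot>) (pr1 ?S)", unfolded g1] by (simp add: x'_def)
    have y: "y = f (n + 1) \<cdot> (pr1 (cone_summands X Y n) \<cdot> h) \<boxplus> Diff Y n \<cdot> y'"
      using arg_cong[OF h, of "(\<cdot>) (pr2 ?S)", unfolded g2] by (simp add: y'_def)
    have "y \<boxplus> f (n + 1) \<cdot> x' = Diff Y n \<cdot> y'"
      unfolding y x'_def by (simp add: y'_def Add_ac)
    with x show "\<exists>x' y'. arr x' \<and> arr y' \<and> src x' = src x \<and> src y' = src x \<and>
        tgt x' = Term X (n + 1) \<and> tgt y' = Term Y n \<and>
        Diff X (n + 1) \<cdot> x' = x \<and> y \<boxplus> f (n + 1) \<cdot> x' = Diff Y n \<cdot> y'"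
      by (intro exI[of _ x'] exI[of _ y']) (simp add: x'_def y'_def)
  qed
next
  note [simp] = cone_simps[OF f]
  assume qi: "quasi_iso_on T X Y f"
  show "exact_on T (cone C X Y f)"
    unfolding exact_on_def
  proof (intro ballI allI impI)
    fix t n g
    assume t: "t \<in> T" and "g \<in> Hom C t (Term (cone C X Y f) (n + 1))"
      and dg: "Diff (cone C X Y f) (n + 1) \<cdot> g = Zero C t (Term (cone C X Y f) (n + 2))"
    then have [simp]: "arr g" "src g = t" "tgt g = vertex (cone_summands X Y (n + 1))"
      by (auto simp: in_Hom_iff)
    have [simp]: "t \<in> Ob C" using src_in_Ob[of g] by simp
    define x where "x = pr1 (cone_summands X Y (n + 1)) \<cdot> g"
    define y where "y = pr2 (cone_summands X Y (n + 1)) \<cdot> g"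
    have [simp]: "arr x" "arr y" "src x = t" "src y = t" "tgt x = Term X (n + 2)" "tgt y = Term Y (n + 1)"
      by (simp_all add: x_def y_def)
    have "Neg C t (Term X (n + 3)) (Diff X (n + 2) \<cdot> x) = Zero C t (Term X (n + 3))"
      using arg_cong[OF dg, of "(\<cdot>) (pr1 (cone_summands X Y (n + 2)))"] by (simp add: x_def)
    from arg_cong[OF this, of "Neg C t (Term X (n + 3))"]
    have "Diff X (n + 2) \<cdot> x = Zero C t (Term X (n + 3))"
      by simp
    moreover have "f (n + 2) \<cdot> x \<boxplus> Diff Y (n + 1) \<cdot> y = Zero C t (Term Y (n + 2))"
      using arg_cong[OF dg, of "(\<cdot>) (pr2 (cone_summands X Y (n + 2)))"] by (simp add: x_def y_def)
    ultimately obtain x' y' where [simp]: "arr x'" "arr y'" "src x' = t" "src y' = t"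
        "tgt x' = Term X (n + 1)" "tgt y' = Term Y n"
      and x: "Diff X (n + 1) \<cdot> x' = x" and y: "y \<boxplus> f (n + 1) \<cdot> x' = Diff Y n \<cdot> y'"
      using quasi_iso_onD[OF qi, of x y n] t by auto
    define h where "h = in1 (cone_summands X Y n) \<cdot> Neg C t (Term X (n + 1)) x' \<boxplus> in2 (cone_summands X Y n) \<cdot> y'"
    have [simp]: "arr h" "src h = t" "tgt h = vertex (cone_summands X Y n)"
      by (simp_all add: h_def)
    have h1: "pr1 (cone_summands X Y n) \<cdot> h = Neg C t (Term X (n + 1)) x'"
      and h2: "pr2 (cone_summands X Y n) \<cdot> h = y'"
      by (simp_all add: h_def)
    have "Diff (cone C X Y f) n \<cdot> h = g"
    proof (rule biprod_eqI[where X = "Term X (n + 1 + 1)" and Y = "Term Y (n + 1)"])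
      show "pr1 (cone_summands X Y (n + 1)) \<cdot> (Diff (cone C X Y f) n \<cdot> h) = pr1 (cone_summands X Y (n + 1)) \<cdot> g"
        by (simp add: h1 x) (simp add: x_def)
      show "pr2 (cone_summands X Y (n + 1)) \<cdot> (Diff (cone C X Y f) n \<cdot> h) = pr2 (cone_summands X Y (n + 1)) \<cdot> g"
        by (simp add: h1 h2 Add_ac flip: y) (simp add: y_def)
    qed auto
    then show "\<exists>h\<in>Hom C t (Term (cone C X Y f) n). Diff (cone C X Y f) n \<cdot> h = g"
      by (intro bexI[of _ h]) (auto simp: in_Hom_iff)
  qed
qed

end

section \<open>Relative quasi-isomorphisms\<close>

context abelian_category
begin

lemma quasi_iso_on_Comp:
  assumes u: "quasi_iso_on T V X u" and s: "quasi_iso_on T X Y s"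
  shows "quasi_iso_on T V Y (\<lambda>n. s n \<cdot> u n)"
proof (rule quasi_iso_onI)
  have u': "u \<in> chain_maps C V X" and s': "s \<in> chain_maps C X Y"
    using u s unfolding quasi_iso_on_def by auto
  note [simp] = chain_maps_simps[OF u'] chain_maps_simps[OF s']
  show "(\<lambda>n. s n \<cdot> u n) \<in> chain_maps C V Y"
    using u' s' by (rule chain_maps_Comp)
  fix n x y
  assume [simp]: "arr x" "arr y" "src y = src x" "tgt x = Term V (n + 2)" "tgt y = Term Y (n + 1)"
    and t: "src x \<in> T"
    and dx [simp]: "Diff V (n + 2) \<cdot> x = Zero C (src x) (Term V (n + 3))"
    and dy: "(s (n + 2) \<cdot> u (n + 2)) \<cdot> x \<boxplus> Diff Y (n + 1) \<cdot> y = Zero C (src x) (Term Y (n + 2))"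
  have [simp]: "src x \<in> Ob C" using src_in_Ob by simp
  obtain z y' where [simp]: "arr z" "arr y'" "src z = src x" "src y' = src x" "tgt z = Term X (n + 1)"
      "tgt y' = Term Y n" and z: "Diff X (n + 1) \<cdot> z = u (n + 2) \<cdot> x"
      and y: "y \<boxplus> s (n + 1) \<cdot> z = Diff Y n \<cdot> y'"
    using quasi_iso_onD[OF s, of "u (n + 2) \<cdot> x" y n] t dy by auto
  obtain x' z' where [simp]: "arr x'" "arr z'" "src x' = src x" "src z' = src x"
      "tgt x' = Term V (n + 1)" "tgt z' = Term X n" and x': "Diff V (n + 1) \<cdot> x' = x"
      and z': "Neg C (src x) (Term X (n + 1)) z \<boxplus> u (n + 1) \<cdot> x' = Diff X n \<cdot> z'"
    using quasi_iso_onD[OF u, of x "Neg C (src x) (Term X (n + 1)) z" n] t by (auto simp: z)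
  \<comment> \<open>The two witnesses add up: \<open>y + s (u x') = y + s z + s (d z') = d (y' + s z')\<close>.\<close>
  have ux: "u (n + 1) \<cdot> x' = z \<boxplus> Diff X n \<cdot> z'"
    by (simp flip: z')
  have "y \<boxplus> (s (n + 1) \<cdot> u (n + 1)) \<cdot> x' = (y \<boxplus> s (n + 1) \<cdot> z) \<boxplus> Diff Y n \<cdot> (s n \<cdot> z')"
    by (simp add: ux Add_assoc)
  also have "\<dots> = Diff Y n \<cdot> (y' \<boxplus> s n \<cdot> z')"
    by (simp add: y)
  finally have "y \<boxplus> (s (n + 1) \<cdot> u (n + 1)) \<cdot> x' = Diff Y n \<cdot> (y' \<boxplus> s n \<cdot> z')" .
  with x' show "\<exists>x' y'. arr x' \<and> arr y' \<and> src x' = src x \<and> src y' = src x \<and>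
        tgt x' = Term V (n + 1) \<and> tgt y' = Term Y n \<and>
        Diff V (n + 1) \<cdot> x' = x \<and> y \<boxplus> (s (n + 1) \<cdot> u (n + 1)) \<cdot> x' = Diff Y n \<cdot> y'"
    by (intro exI[of _ x'] exI[of _ "y' \<boxplus> s n \<cdot> z'"]) simp
qed

lemma quasi_iso_on_Id:
  assumes [simp]: "cochain_complex C X"
  shows "quasi_iso_on T X X (\<lambda>n. Id C (Term X n))"
proof (rule quasi_iso_onI)
  show "(\<lambda>n. Id C (Term X n)) \<in> chain_maps C X X"
    by (simp add: chain_maps_Id)
  fix n x y
  assume [simp]: "arr x" "arr y" "src y = src x" "tgt x = Term X (n + 2)" "tgt y = Term X (n + 1)"
    and dy: "Id C (Term X (n + 2)) \<cdot> x \<boxplus> Diff X (n + 1) \<cdot> y = Zero C (src x) (Term X (n + 2))"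
  have [simp]: "src x \<in> Ob C" using src_in_Ob by simp
  have x: "x = Neg C (src x) (Term X (n + 2)) (Diff X (n + 1) \<cdot> y)"
    by (rule Add_eq_Zero_imp) (use dy in auto)
  show "\<exists>x' y'. arr x' \<and> arr y' \<and> src x' = src x \<and> src y' = src x \<and>
        tgt x' = Term X (n + 1) \<and> tgt y' = Term X n \<and>
        Diff X (n + 1) \<cdot> x' = x \<and> y \<boxplus> Id C (Term X (n + 1)) \<cdot> x' = Diff X n \<cdot> y'"
    by (rule exI[of _ "Neg C (src x) (Term X (n + 1)) y"], rule exI[of _ "Zero C (src x) (Term X n)"])
      (use x in simp)
qed

lemma quasi_iso_on_from_zero:
  assumes [simp]: "cochain_complex C V" "cochain_complex C D" and V: "\<And>n. zero_object C (Term V n)"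
    and ex: "exact_on T D"
  shows "quasi_iso_on T V D (\<lambda>n. Zero C (Term V n) (Term D n))"
proof (rule quasi_iso_onI)
  show "(\<lambda>n. Zero C (Term V n) (Term D n)) \<in> chain_maps C V D"
    by (simp add: chain_maps_Zero)
  fix n x y
  assume [simp]: "arr x" "arr y" "src y = src x" "tgt x = Term V (n + 2)" "tgt y = Term D (n + 1)"
    and t: "src x \<in> T"
    and dy: "Zero C (Term V (n + 2)) (Term D (n + 2)) \<cdot> x \<boxplus> Diff D (n + 1) \<cdot> y = Zero C (src x) (Term D (n + 2))"
  have [simp]: "src x \<in> Ob C" using src_in_Ob by simp
  obtain y' where [simp]: "arr y'" "src y' = src x" "tgt y' = Term D n" and y: "Diff D n \<cdot> y' = y"
    using exact_onD[OF ex, of y n] t dy by auto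
  have x: "x = Zero C (src x) (Term V (n + 2))"
    using zero_object_target[OF V] by simp
  show "\<exists>x' y'. arr x' \<and> arr y' \<and> src x' = src x \<and> src y' = src x \<and>
        tgt x' = Term V (n + 1) \<and> tgt y' = Term D n \<and>
        Diff V (n + 1) \<cdot> x' = x \<and> y \<boxplus> Zero C (Term V (n + 1)) (Term D (n + 1)) \<cdot> x' = Diff D n \<cdot> y'"
    by (rule exI[of _ "Zero C (src x) (Term V (n + 1))"], rule exI[of _ y'])
      (use x in \<open>simp add: y\<close>)
qed

text \<open>Every chain map \<open>f\<close> into a relatively exact complex becomes null homotopic after composition
  with a relative quasi-isomorphism \<open>u\<close>, namely the projection of the desuspended cone of \<open>f\<close>, with
  terms \<open>X n \<oplus> D (n - 1)\<close>, onto its first summand.  The projection onto the second summand is the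
  homotopy.\<close>

lemma ex_quasi_iso_null_homotopic:
  assumes f: "f \<in> chain_maps C X D" and ex: "exact_on T D"
  shows "\<exists>V u. quasi_iso_on T V X u \<and>
    (\<lambda>n. f n \<cdot> u n, \<lambda>n. Zero C (Term V n) (Term D n)) \<in> homotopy_rel C V D"
proof -
  note [simp] = cone_simps[OF f] cochain_complex_cone[OF f]
  let ?cone = "cone C X D f"
  define V where "V = \<lparr>Term = (\<lambda>n. Term ?cone (n - 1)),
    Diff = (\<lambda>n. Neg C (Term ?cone (n - 1)) (Term ?cone n) (Diff ?cone (n - 1)))\<rparr>"
  define u where "u n = pr1 (biprod C (Term X n) (Term D (n - 1)))" for n
  define h where "h n = pr2 (biprod C (Term X n) (Term D (n - 1)))" for n
  have Term_V [simp]: "Term V n = vertex (biprod C (Term X n) (Term D (n - 1)))" for n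
    by (simp add: V_def)
  have Diff_V [simp]: "Diff V n = Neg C (vertex (biprod C (Term X n) (Term D (n - 1))))
      (vertex (biprod C (Term X (n + 1)) (Term D n))) (Diff ?cone (n - 1))" for n
    by (simp add: V_def)
  have V: "cochain_complex C V"
    by (rule cochain_complexI) (auto simp: in_Hom_iff add.commute)
  have u: "u \<in> chain_maps C V X"
    by (rule chain_mapsI) (auto simp: V u_def in_Hom_iff)
  have fu: "(\<lambda>n. f n \<cdot> u n) \<in> chain_maps C V D"
    by (rule chain_maps_Comp[OF u f])
  have "quasi_iso_on T V X u"
  proof (rule quasi_iso_onI[OF u])
    fix n x y
    assume [simp]: "arr x" "arr y" "src y = src x" and tgt_x: "tgt x = Term V (n + 2)" and [simp]: "tgt y = Term X (n + 1)"
      and t: "src x \<in> T"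
      and dx: "Diff V (n + 2) \<cdot> x = Zero C (src x) (Term V (n + 3))"
      and dy: "u (n + 2) \<cdot> x \<boxplus> Diff X (n + 1) \<cdot> y = Zero C (src x) (Term X (n + 2))"
    have [simp]: "src x \<in> Ob C" using src_in_Ob by simp
    have [simp]: "tgt x = vertex (biprod C (Term X (n + 2)) (Term D (n + 1)))"
      using tgt_x by simp
    define b where "b = pr2 (biprod C (Term X (n + 2)) (Term D (n + 1))) \<cdot> x"
    have [simp]: "arr b" "src b = src x" "tgt b = Term D (n + 1)"
      by (simp_all add: b_def)
    have a: "pr1 (biprod C (Term X (n + 2)) (Term D (n + 1))) \<cdot> x = Neg C (src x) (Term X (n + 2)) (Diff X (n + 1) \<cdot> y)"
      by (rule Add_eq_Zero_imp) (use dy in \<open>auto simp: u_def\<close>)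
    have "Neg C (src x) (vertex (biprod C (Term X (n + 3)) (Term D (n + 2)))) (Diff ?cone (n + 1) \<cdot> x)
      = Zero C (src x) (vertex (biprod C (Term X (n + 3)) (Term D (n + 2))))"
      using dx by simp
    from arg_cong[OF this, of "Neg C (src x) (vertex (biprod C (Term X (n + 3)) (Term D (n + 2))))"]
    have "Diff ?cone (n + 1) \<cdot> x = Zero C (src x) (vertex (biprod C (Term X (n + 3)) (Term D (n + 2))))"
      by simp
    from arg_cong[OF this, of "(\<cdot>) (pr2 (biprod C (Term X (n + 3)) (Term D (n + 2))))"]
    have db: "Neg C (src x) (Term D (n + 2)) (f (n + 2) \<cdot> (Diff X (n + 1) \<cdot> y)) \<boxplus> Diff D (n + 1) \<cdot> b = Zero C (src x) (Term D (n + 2))"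
      by (simp add: a b_def)
    \<comment> \<open>Since \<open>x\<close> is a cocycle with first component \<open>- d y\<close>, its second component \<open>b\<close> satisfies
      \<open>d b = f (d y)\<close>.  Hence \<open>b - f y\<close> is a cocycle of \<open>D\<close>, and so a coboundary.\<close>
    define e where "e = Neg C (src x) (Term D (n + 1)) (f (n + 1) \<cdot> y) \<boxplus> b"
    have [simp]: "arr e" "src e = src x" "tgt e = Term D (n + 1)"
      by (simp_all add: e_def)
    have "Diff D (n + 1) \<cdot> e = Zero C (src x) (Term D (n + 2))"
      using db by (simp add: e_def chain_maps_Diff_Comp[OF f])
    then obtain c where [simp]: "arr c" "src c = src x" "tgt c = Term D n" and c: "Diff D n \<cdot> c = e"
      using exact_onD[OF ex, of e n] t by auto
    define x' where "x' = Neg C (src x) (vertex (biprod C (Term X (n + 1)) (Term D n)))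
      (in1 (biprod C (Term X (n + 1)) (Term D n)) \<cdot> y \<boxplus> in2 (biprod C (Term X (n + 1)) (Term D n)) \<cdot> c)"
    have [simp]: "arr x'" "src x' = src x" "tgt x' = vertex (biprod C (Term X (n + 1)) (Term D n))"
      by (simp_all add: x'_def)
    have x'1: "pr1 (biprod C (Term X (n + 1)) (Term D n)) \<cdot> x' = Neg C (src x) (Term X (n + 1)) y"
      and x'2: "pr2 (biprod C (Term X (n + 1)) (Term D n)) \<cdot> x' = Neg C (src x) (Term D n) c"
      by (simp_all add: x'_def)
    have "Diff V (n + 1) \<cdot> x' = x"
      by (rule biprod_eqI[where X = "Term X (n + 2)" and Y = "Term D (n + 1)"])
        (auto simp: x'1 x'2 a c e_def Add_ac simp flip: b_def)
    then show "\<exists>x' y'. arr x' \<and> arr y' \<and> src x' = src x \<and> src y' = src x \<and>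
        tgt x' = Term V (n + 1) \<and> tgt y' = Term X n \<and>
        Diff V (n + 1) \<cdot> x' = x \<and> y \<boxplus> u (n + 1) \<cdot> x' = Diff X n \<cdot> y'"
      by (intro exI[of _ x'] exI[of _ "Zero C (src x) (Term X n)"]) (simp add: u_def x'1)
  qed
  moreover have "(\<lambda>n. f n \<cdot> u n, \<lambda>n. Zero C (Term V n) (Term D n)) \<in> homotopy_rel C V D"
  proof (rule homotopy_relI[OF fu chain_maps_Zero[OF V], where h = h])
    fix n
    show "Zero C (Term V n) (Term D n) = f n \<cdot> u n \<boxplus> (Diff D (n - 1) \<cdot> h n \<boxplus> h (n + 1) \<cdot> Diff V n)"
      by (simp add: u_def h_def flip: Neg_of_Add) (simp del: Neg_of_Add flip: Add_assoc)
  qed (auto simp: h_def in_Hom_iff)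
  ultimately show ?thesis
    by blast
qed

lemma cone_inclusion:
  assumes f: "f \<in> chain_maps C X Y"
  shows "(\<lambda>n. in2 (cone_summands X Y n)) \<in> chain_maps C Y (cone C X Y f)"
proof (rule chain_mapsI)
  note [simp] = cone_simps[OF f]
  show "cochain_complex C Y" by simp
  show "cochain_complex C (cone C X Y f)" by (rule cochain_complex_cone[OF f])
  fix n
  show "in2 (cone_summands X Y n) \<in> Hom C (Term Y n) (Term (cone C X Y f) n)"
    by (simp add: in_Hom_iff)
  show "Diff (cone C X Y f) n \<cdot> in2 (cone_summands X Y n) = in2 (cone_summands X Y (n + 1)) \<cdot> Diff Y n"
    by (rule biprod_eqI[where X = "Term X (n + 2)" and Y = "Term Y (n + 1)"]) auto
qed

text \<open>A null homotopy of \<open>V \<rightarrow> Y \<rightarrow> cone b\<close> has components \<open>h1 : V n \<rightarrow> X n\<close> and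
  \<open>h2 : V n \<rightarrow> Y (n - 1)\<close>; the first one is, up to sign, a lift of \<open>V \<rightarrow> Y\<close> along \<open>b\<close>, and the second
  one a homotopy that compares the two.\<close>

lemma lift_along_null_homotopy:
  assumes b: "b \<in> chain_maps C X Y" and g: "g \<in> chain_maps C V Y"
    and null: "(\<lambda>n. in2 (cone_summands X Y n) \<cdot> g n, \<lambda>n. Zero C (Term V n) (Term (cone C X Y b) n))
      \<in> homotopy_rel C V (cone C X Y b)"
  shows "\<exists>v \<in> chain_maps C V X. (g, \<lambda>n. b n \<cdot> v n) \<in> homotopy_rel C V Y"
  using null
proof (rule homotopy_relE)
  fix h
  note [simp] = cone_simps[OF b] chain_maps_typing[OF g]
  assume [simp]: "\<And>n. arr (h n)" "\<And>n. src (h n) = Term V n" and "\<And>n. tgt (h n) = Term (cone C X Y b) (n - 1)"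
    and h: "\<And>n. Zero C (Term V n) (Term (cone C X Y b) n) = in2 (cone_summands X Y n) \<cdot> g n \<boxplus>
      (Diff (cone C X Y b) (n - 1) \<cdot> h n \<boxplus> h (n + 1) \<cdot> Diff V n)"
  then have [simp]: "tgt (h n) = vertex (biprod C (Term X n) (Term Y (n - 1)))" for n
    by simp
  define h1 where "h1 n = pr1 (biprod C (Term X n) (Term Y (n - 1))) \<cdot> h n" for n
  define h2 where "h2 n = pr2 (biprod C (Term X n) (Term Y (n - 1))) \<cdot> h n" for n
  have [simp]: "arr (h1 n)" "src (h1 n) = Term V n" "tgt (h1 n) = Term X n"
    "arr (h2 n)" "src (h2 n) = Term V n" "tgt (h2 n) = Term Y (n - 1)" for n
    by (simp_all add: h1_def h2_def)
  define v where "v n = Neg C (Term V n) (Term X n) (h1 n)" for n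
  have [simp]: "arr (v n)" "src (v n) = Term V n" "tgt (v n) = Term X n" for n
    by (simp_all add: v_def)
  have pr_h: "pr1 (biprod C (Term X (n + 1)) (Term Y n)) \<cdot> (h (n + 1) \<cdot> Diff V n) = h1 (n + 1) \<cdot> Diff V n"
      "pr2 (biprod C (Term X (n + 1)) (Term Y n)) \<cdot> (h (n + 1) \<cdot> Diff V n) = h2 (n + 1) \<cdot> Diff V n" for n
    by (simp_all add: h1_def h2_def)
  have 1: "h1 (n + 1) \<cdot> Diff V n = Diff X n \<cdot> h1 n" for n
  proof -
    have "Neg C (Term V n) (Term X (n + 1)) (Diff X n \<cdot> h1 n) \<boxplus> h1 (n + 1) \<cdot> Diff V n = Zero C (Term V n) (Term X (n + 1))"
      using arg_cong[OF h[of n], of "(\<cdot>) (pr1 (cone_summands X Y n))"]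
      by (simp add: pr_h flip: h1_def)
    then have "h1 (n + 1) \<cdot> Diff V n = Neg C (Term V n) (Term X (n + 1)) (Neg C (Term V n) (Term X (n + 1)) (Diff X n \<cdot> h1 n))"
      by (intro Neg_unique) auto
    then show ?thesis by simp
  qed
  have v: "v \<in> chain_maps C V X"
    by (rule chain_mapsI) (auto simp: v_def 1 in_Hom_iff)
  have 2: "b n \<cdot> v n = g n \<boxplus> (Diff Y (n - 1) \<cdot> h2 n \<boxplus> h2 (n + 1) \<cdot> Diff V n)" for n
  proof -
    have "b n \<cdot> h1 n \<boxplus> (g n \<boxplus> (Diff Y (n - 1) \<cdot> h2 n \<boxplus> h2 (n + 1) \<cdot> Diff V n)) = Zero C (Term V n) (Term Y n)"
      using arg_cong[OF h[of n], of "(\<cdot>) (pr2 (cone_summands X Y n))"]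
      by (simp add: pr_h Add_ac flip: h1_def h2_def)
    from Neg_unique[OF _ _ _ _ _ _ this] show ?thesis
      by (simp add: v_def)
  qed
  have "(g, \<lambda>n. b n \<cdot> v n) \<in> homotopy_rel C V Y"
    by (rule homotopy_relI[OF g chain_maps_Comp[OF v b], where h = h2]) (auto simp: in_Hom_iff 2)
  with v show ?thesis by blast
qed

end

section \<open>Relatively exact complexes are zero objects of the localization\<close>

lemma ex1_Hom_localization:
  assumes "X \<in> Ob K" "Y \<in> Ob K" "roofs K W X Y \<noteq> {}"
    and "\<And>r r'. r \<in> roofs K W X Y \<Longrightarrow> r' \<in> roofs K W X Y \<Longrightarrow> (r, r') \<in> roof_rel K W X Y"
  shows "\<exists>!a. a \<in> Hom (localization K W) X Y"
proof -
  have "roof_rel K W X Y `` {r} = roofs K W X Y" if "r \<in> roofs K W X Y" for r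
    using assms(4)[OF that] by (auto simp: roof_rel_def)
  then have "roofs K W X Y // roof_rel K W X Y = {roofs K W X Y}"
    using assms(3) by (auto simp: quotient_def)
  then show ?thesis
    using assms(1,2) by (auto simp: localization_def)
qed

context abelian_category
begin

text \<open>The complexes by which the homotopy category is divided.\<close>

definition exact_complexes :: "'o set \<Rightarrow> ('o, 'm) complex_data set" where
  "exact_complexes T = {S. cochain_complex C S \<and> exact_on T S}"

text \<open>The arrows at which the homotopy category is localized: those represented by a chain map with
  relatively exact cone.\<close>

definition inverted :: "'o set \<Rightarrow> ('o, 'm) homotopy_arrow set" where
  "inverted T = {(X, Y, \<alpha>) |X Y \<alpha>. (X, Y, \<alpha>) \<in> Hom (homotopy_category C) X Y \<and>
     (\<exists>f \<in> \<alpha>. cone C X Y f \<in> exact_complexes T)}"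

lemma verdier_localization_exact_complexes:
  "verdier_localization C (exact_complexes T) = localization (homotopy_category C) (inverted T)"
  by (simp add: verdier_localization_def inverted_def)

lemma inverted_iff: "a \<in> inverted T \<longleftrightarrow> (\<exists>X Y f. quasi_iso_on T X Y f \<and> a = homotopy_class X Y f)"
proof
  assume "a \<in> inverted T"
  then obtain X Y \<alpha> f where a: "a = (X, Y, \<alpha>)" "(X, Y, \<alpha>) \<in> Hom (homotopy_category C) X Y" "f \<in> \<alpha>"
    and ex: "exact_on T (cone C X Y f)"
    by (auto simp: inverted_def exact_complexes_def)
  then obtain g where g: "(X, Y, \<alpha>) = homotopy_class X Y g"
    by (auto simp: Hom_homotopy_category)
  then have gf: "(g, f) \<in> homotopy_rel C X Y"
    using a(3) by (simp add: homotopy_class_def)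
  then have "f \<in> chain_maps C X Y"
    by (auto simp: homotopy_rel_def)
  then have "quasi_iso_on T X Y f"
    using ex exact_on_cone_iff by blast
  moreover have "a = homotopy_class X Y f"
    using a(1) g homotopy_class_eqI[OF gf] by simp
  ultimately show "\<exists>X Y f. quasi_iso_on T X Y f \<and> a = homotopy_class X Y f"
    by blast
next
  assume "\<exists>X Y f. quasi_iso_on T X Y f \<and> a = homotopy_class X Y f"
  then obtain X Y f where qi: "quasi_iso_on T X Y f" and a: "a = homotopy_class X Y f"
    by blast
  then have f: "f \<in> chain_maps C X Y"
    by (simp add: quasi_iso_on_def)
  have "f \<in> homotopy_rel C X Y `` {f}"
    using homotopy_rel_refl[OF f] by simp
  moreover have "cone C X Y f \<in> exact_complexes T"
    using qi exact_on_cone_iff[OF f] cochain_complex_cone[OF f] by (simp add: exact_complexes_def)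
  moreover have "homotopy_class X Y f \<in> Hom (homotopy_category C) X Y"
    using f by (simp add: Hom_homotopy_category)
  ultimately show "a \<in> inverted T"
    unfolding inverted_def a homotopy_class_def by blast
qed

lemma roofE:
  assumes "r \<in> roofs (homotopy_category C) (inverted T) X Y"
  obtains Z s f where "r = (homotopy_class Z X s, homotopy_class Z Y f)" "quasi_iso_on T Z X s"
    "s \<in> chain_maps C Z X" "f \<in> chain_maps C Z Y"
proof -
  from assms obtain a b Z where r: "r = (a, b)" "a \<in> inverted T" "a \<in> Hom (homotopy_category C) Z X"
    "b \<in> Hom (homotopy_category C) Z Y"
    by (auto simp: roofs_def)
  then obtain f where f: "f \<in> chain_maps C Z Y" "b = homotopy_class Z Y f"
    by (auto simp: Hom_homotopy_category)
  from r(2) obtain X' Y' s where s: "quasi_iso_on T X' Y' s" "a = homotopy_class X' Y' s"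
    using inverted_iff by blast
  then have "X' = Z" "Y' = X"
    using r(3) by (auto simp: Hom_homotopy_category homotopy_class_def)
  then show ?thesis
    using that[of Z s f] s f r(1) by (simp add: quasi_iso_on_def)
qed

lemma roofI:
  assumes "quasi_iso_on T Z X s" "f \<in> chain_maps C Z Y"
  shows "(homotopy_class Z X s, homotopy_class Z Y f) \<in> roofs (homotopy_category C) (inverted T) X Y"
proof -
  have "s \<in> chain_maps C Z X"
    using assms(1) by (simp add: quasi_iso_on_def)
  moreover have "homotopy_class Z X s \<in> inverted T"
    using assms(1) inverted_iff by blast
  ultimately show ?thesis
    using assms(2) unfolding roofs_def by (auto simp: Hom_homotopy_category)
qed

lemma roof_relI:
  assumes s: "quasi_iso_on T Z X s" "quasi_iso_on T Z' X s'"
    and f: "f \<in> chain_maps C Z Y" "f' \<in> chain_maps C Z' Y"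
    and u: "u \<in> chain_maps C V Z" "u' \<in> chain_maps C V Z'"
    and "quasi_iso_on T V X (\<lambda>n. s n \<cdot> u n)"
    and su: "(\<lambda>n. s n \<cdot> u n, \<lambda>n. s' n \<cdot> u' n) \<in> homotopy_rel C V X"
    and fu: "(\<lambda>n. f n \<cdot> u n, \<lambda>n. f' n \<cdot> u' n) \<in> homotopy_rel C V Y"
  shows "((homotopy_class Z X s, homotopy_class Z Y f), (homotopy_class Z' X s', homotopy_class Z' Y f'))
    \<in> roof_rel (homotopy_category C) (inverted T) X Y"
proof -
  let ?K = "homotopy_category C"
  have s': "s \<in> chain_maps C Z X" "s' \<in> chain_maps C Z' X"
    using s by (simp_all add: quasi_iso_on_def)
  have "homotopy_class Z X s \<cdot>\<^bsub>?K\<^esub> homotopy_class V Z u = homotopy_class Z' X s' \<cdot>\<^bsub>?K\<^esub> homotopy_class V Z' u'"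
    "homotopy_class Z Y f \<cdot>\<^bsub>?K\<^esub> homotopy_class V Z u = homotopy_class Z' Y f' \<cdot>\<^bsub>?K\<^esub> homotopy_class V Z' u'"
    using s' f u homotopy_class_eqI[OF su] homotopy_class_eqI[OF fu] by (simp_all add: Comp_homotopy_class)
  moreover have "homotopy_class Z X s \<cdot>\<^bsub>?K\<^esub> homotopy_class V Z u \<in> inverted T"
    using assms(7) s' u by (auto simp: Comp_homotopy_class inverted_iff)
  moreover have "homotopy_class V Z u \<in> Hom ?K V Z" "homotopy_class V Z' u' \<in> Hom ?K V Z'"
    "homotopy_class Z X s \<in> Hom ?K Z X" "homotopy_class Z' X s' \<in> Hom ?K Z' X"
    using s' u by (simp_all add: Hom_homotopy_category)
  moreover note roofI[OF s(1) f(1)] roofI[OF s(2) f(2)]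
  ultimately show ?thesis
    unfolding roof_rel_def by blast
qed

lemma ex_zero_complex: "\<exists>V. cochain_complex C V \<and> (\<forall>n. zero_object C (Term V n))"
proof -
  obtain Z where Z: "zero_object C Z" "Z \<in> Ob C"
    using ex_zero_object zero_object_Ob by blast
  then show ?thesis
    by (intro exI[of _ "\<lparr>Term = \<lambda>_. Z, Diff = \<lambda>_. Zero C Z Z\<rparr>"])
      (auto simp: cochain_complex_def in_Hom_iff)
qed

text \<open>All roofs \<open>S \<leftarrow> Z \<rightarrow> Y\<close> are refined by the roof \<open>S \<leftarrow> 0 \<rightarrow> Y\<close>, whose left leg is inverted because
  \<open>S\<close> is relatively exact.\<close>

lemma roofs_from_exact:
  assumes [simp]: "cochain_complex C S" "cochain_complex C Y" and ex: "exact_on T S"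
  shows "\<exists>!a. a \<in> Hom (localization (homotopy_category C) (inverted T)) S Y"
proof (rule ex1_Hom_localization)
  obtain V where [simp]: "cochain_complex C V" and V: "\<And>n. zero_object C (Term V n)"
    using ex_zero_complex by blast
  have zero: "quasi_iso_on T V S (\<lambda>n. Zero C (Term V n) (Term S n))"
    by (rule quasi_iso_on_from_zero) (use V ex in auto)
  from roofI[OF zero chain_maps_Zero[of V Y]]
  show "roofs (homotopy_category C) (inverted T) S Y \<noteq> {}"
    by auto
  fix r r'
  assume "r \<in> roofs (homotopy_category C) (inverted T) S Y" "r' \<in> roofs (homotopy_category C) (inverted T) S Y"
  then obtain Z s f Z' s' f' where r: "r = (homotopy_class Z S s, homotopy_class Z Y f)"
      "r' = (homotopy_class Z' S s', homotopy_class Z' Y f')"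
    and qi: "quasi_iso_on T Z S s" "quasi_iso_on T Z' S s'"
    and s: "s \<in> chain_maps C Z S" "s' \<in> chain_maps C Z' S"
    and f: "f \<in> chain_maps C Z Y" "f' \<in> chain_maps C Z' Y"
    by (elim roofE)
  note [simp] = chain_maps_typing[OF s(1)] chain_maps_typing[OF s(2)] chain_maps_typing[OF f(1)] chain_maps_typing[OF f(2)]
  show "(r, r') \<in> roof_rel (homotopy_category C) (inverted T) S Y"
    unfolding r
    by (rule roof_relI[OF qi f, where u = "\<lambda>n. Zero C (Term V n) (Term Z n)" and u' = "\<lambda>n. Zero C (Term V n) (Term Z' n)" and V = V])
      (auto simp: zero intro!: chain_maps_Zero homotopy_rel_refl)
qed (auto simp: Ob_homotopy_category)

text \<open>Given two roofs \<open>Y \<leftarrow> Z \<rightarrow> S\<close> and \<open>Y \<leftarrow> Z' \<rightarrow> S\<close>, a common refinement is built in three steps: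
  \<open>u1\<close> kills the map from \<open>Z\<close> to the cone of \<open>s'\<close>, which makes the left legs agree (an Ore
  square); then \<open>u2\<close> and \<open>u3\<close> kill the two maps into the relatively exact complex \<open>S\<close>.\<close>

lemma roofs_to_exact:
  assumes [simp]: "cochain_complex C S" "cochain_complex C Y" and ex: "exact_on T S"
  shows "\<exists>!a. a \<in> Hom (localization (homotopy_category C) (inverted T)) Y S"
proof (rule ex1_Hom_localization)
  from roofI[OF quasi_iso_on_Id[of Y] chain_maps_Zero[of Y S]]
  show "roofs (homotopy_category C) (inverted T) Y S \<noteq> {}"
    by auto
  fix r r'
  assume "r \<in> roofs (homotopy_category C) (inverted T) Y S" "r' \<in> roofs (homotopy_category C) (inverted T) Y S"
  then obtain Z s f Z' s' f' where r: "r = (homotopy_class Z Y s, homotopy_class Z S f)"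
      "r' = (homotopy_class Z' Y s', homotopy_class Z' S f')"
    and qi: "quasi_iso_on T Z Y s" "quasi_iso_on T Z' Y s'"
    and s: "s \<in> chain_maps C Z Y" "s' \<in> chain_maps C Z' Y"
    and f: "f \<in> chain_maps C Z S" "f' \<in> chain_maps C Z' S"
    by (elim roofE)
  note [simp] = chain_maps_typing[OF s(1)] chain_maps_typing[OF s(2)] chain_maps_typing[OF f(1)] chain_maps_typing[OF f(2)]
  have "exact_on T (cone C Z' Y s')"
    using qi(2) exact_on_cone_iff[OF s(2)] by simp
  from ex_quasi_iso_null_homotopic[OF chain_maps_Comp[OF s(1) cone_inclusion[OF s(2)]] this]
  obtain V1 u1 where qi1: "quasi_iso_on T V1 Z u1"
    and "(\<lambda>n. (in2 (cone_summands Z' Y n) \<cdot> s n) \<cdot> u1 n, \<lambda>n. Zero C (Term V1 n) (Term (cone C Z' Y s') n))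
      \<in> homotopy_rel C V1 (cone C Z' Y s')"
    by blast
  then have u1: "u1 \<in> chain_maps C V1 Z"
    and null: "(\<lambda>n. in2 (cone_summands Z' Y n) \<cdot> (s n \<cdot> u1 n), \<lambda>n. Zero C (Term V1 n) (Term (cone C Z' Y s') n))
      \<in> homotopy_rel C V1 (cone C Z' Y s')"
    by (auto simp: quasi_iso_on_def chain_maps_typing)
  note [simp] = chain_maps_typing[OF u1]
  obtain v where v: "v \<in> chain_maps C V1 Z'"
    and su1: "(\<lambda>n. s n \<cdot> u1 n, \<lambda>n. s' n \<cdot> v n) \<in> homotopy_rel C V1 Y"
    using lift_along_null_homotopy[OF s(2) chain_maps_Comp[OF u1 s(1)] null] by blast
  note [simp] = chain_maps_typing[OF v]
  obtain V2 u2 where qi2: "quasi_iso_on T V2 V1 u2"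
    and fu2: "(\<lambda>n. (f n \<cdot> u1 n) \<cdot> u2 n, \<lambda>n. Zero C (Term V2 n) (Term S n)) \<in> homotopy_rel C V2 S"
    using ex_quasi_iso_null_homotopic[OF chain_maps_Comp[OF u1 f(1)] ex] by blast
  then have u2: "u2 \<in> chain_maps C V2 V1"
    by (simp add: quasi_iso_on_def)
  note [simp] = chain_maps_typing[OF u2]
  obtain V3 u3 where qi3: "quasi_iso_on T V3 V2 u3"
    and fu3: "(\<lambda>n. (f' n \<cdot> (v n \<cdot> u2 n)) \<cdot> u3 n, \<lambda>n. Zero C (Term V3 n) (Term S n)) \<in> homotopy_rel C V3 S"
    using ex_quasi_iso_null_homotopic[OF chain_maps_Comp[OF chain_maps_Comp[OF u2 v] f(2)] ex] by blast
  then have u3: "u3 \<in> chain_maps C V3 V2"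
    by (simp add: quasi_iso_on_def)
  note [simp] = chain_maps_typing[OF u3]
  note u23 = chain_maps_Comp[OF u3 u2]
  show "(r, r') \<in> roof_rel (homotopy_category C) (inverted T) Y S"
    unfolding r
  proof (rule roof_relI[OF qi f])
    show "(\<lambda>n. u1 n \<cdot> (u2 n \<cdot> u3 n)) \<in> chain_maps C V3 Z"
      by (rule chain_maps_Comp[OF u23 u1])
    show "(\<lambda>n. v n \<cdot> (u2 n \<cdot> u3 n)) \<in> chain_maps C V3 Z'"
      by (rule chain_maps_Comp[OF u23 v])
    show "quasi_iso_on T V3 Y (\<lambda>n. s n \<cdot> (u1 n \<cdot> (u2 n \<cdot> u3 n)))"
      by (rule quasi_iso_on_Comp[OF quasi_iso_on_Comp[OF quasi_iso_on_Comp[OF qi3 qi2] qi1] qi(1)])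
    show "(\<lambda>n. s n \<cdot> (u1 n \<cdot> (u2 n \<cdot> u3 n)), \<lambda>n. s' n \<cdot> (v n \<cdot> (u2 n \<cdot> u3 n))) \<in> homotopy_rel C V3 Y"
      using homotopy_rel_Comp_right[OF su1 u23] by simp
    have "(\<lambda>n. f n \<cdot> (u1 n \<cdot> (u2 n \<cdot> u3 n)), \<lambda>n. Zero C (Term V3 n) (Term S n)) \<in> homotopy_rel C V3 S"
      using homotopy_rel_Comp_right[OF fu2 u3] by simp
    moreover have "(\<lambda>n. Zero C (Term V3 n) (Term S n), \<lambda>n. f' n \<cdot> (v n \<cdot> (u2 n \<cdot> u3 n))) \<in> homotopy_rel C V3 S"
      using homotopy_rel_sym[OF fu3] by simp
    ultimately show "(\<lambda>n. f n \<cdot> (u1 n \<cdot> (u2 n \<cdot> u3 n)), \<lambda>n. f' n \<cdot> (v n \<cdot> (u2 n \<cdot> u3 n))) \<in> homotopy_rel C V3 S"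
      by (rule homotopy_rel_trans)
  qed
qed (auto simp: Ob_homotopy_category)

theorem zero_object_verdier_localization:
  assumes "cochain_complex C S" "exact_on T S"
  shows "zero_object (verdier_localization C (exact_complexes T)) S"
  using assms roofs_from_exact roofs_to_exact
  unfolding zero_object_def verdier_localization_exact_complexes
  by (auto simp: localization_def Ob_homotopy_category)

end

section \<open>Contractible complexes\<close>

context abelian_category
begin

lemma kernelE:
  assumes "is_kernel C X Y f K k"
  obtains "arr k" "src k = K" "tgt k = X" "f \<cdot> k = Zero C K Y"
    "\<And>g. arr g \<Longrightarrow> tgt g = X \<Longrightarrow> f \<cdot> g = Zero C (src g) Y \<Longrightarrow> \<exists>h. arr h \<and> src h = src g \<and> tgt h = K \<and> k \<cdot> h = g"
    "\<And>a b. arr a \<Longrightarrow> arr b \<Longrightarrow> src a = src b \<Longrightarrow> tgt a = K \<Longrightarrow> tgt b = K \<Longrightarrow> k \<cdot> a = k \<cdot> b \<Longrightarrow> a = b"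
proof
  have f [simp]: "arr f" "src f = X" "tgt f = Y" and k [simp]: "arr k" "src k = K" "tgt k = X" "f \<cdot> k = Zero C K Y"
    and *: "\<And>Z g. g \<in> Hom C Z X \<Longrightarrow> f \<cdot> g = Zero C Z Y \<Longrightarrow> \<exists>!h. h \<in> Hom C Z K \<and> k \<cdot> h = g"
    using assms unfolding is_kernel_def by (auto simp: in_Hom_iff)
  show "arr k" "src k = K" "tgt k = X" "f \<cdot> k = Zero C K Y" by simp_all
  show "\<exists>h. arr h \<and> src h = src g \<and> tgt h = K \<and> k \<cdot> h = g"
    if "arr g" "tgt g = X" "f \<cdot> g = Zero C (src g) Y" for g
    using *[of g "src g"] that by (auto simp: in_Hom_iff)
  show "a = b" if [simp]: "arr a" "arr b" "src a = src b" "tgt a = K" "tgt b = K" and kab: "k \<cdot> a = k \<cdot> b" for a b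
  proof -
    have [simp]: "Y \<in> Ob C" using tgt_in_Ob[of f] by simp
    have "f \<cdot> (k \<cdot> b) = (f \<cdot> k) \<cdot> b"
      by (simp del: k(4))
    then have "f \<cdot> (k \<cdot> b) = Zero C (src b) Y"
      by simp
    then have "\<exists>!h. h \<in> Hom C (src b) K \<and> k \<cdot> h = k \<cdot> b"
      using *[of "k \<cdot> b" "src b"] by (simp add: in_Hom_iff)
    moreover have "a \<in> Hom C (src b) K" "b \<in> Hom C (src b) K"
      by (simp_all add: in_Hom_iff)
    ultimately show ?thesis
      using kab by blast
  qed
qed

text \<open>If every cocycle with values in \<open>D\<close> is a coboundary, then so are the inclusions \<open>k n\<close> of the
  kernels: \<open>k n = d (\<sigma> n)\<close>.  With \<open>d = k (n + 1) \<pi>\<close> and \<open>1 - \<sigma> \<pi> = k n \<tau>\<close>, the maps \<open>\<sigma> \<tau>\<close> form a contracting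
  homotopy.\<close>

lemma contractible_if_exact_on:
  assumes [simp]: "cochain_complex C D" and ex: "exact_on (Ob C) D"
  shows "contractible C D"
proof -
  have "\<exists>K k. is_kernel C (Term D n) (Term D (n + 1)) (Diff D n) K k" for n
    by (rule ex_kernel) (simp add: in_Hom_iff)
  then obtain K k where ker: "\<And>n. is_kernel C (Term D n) (Term D (n + 1)) (Diff D n) (K n) (k n)"
    by metis
  have [simp]: "arr (k n)" "src (k n) = K n" "tgt (k n) = Term D n" "Diff D n \<cdot> k n = Zero C (K n) (Term D (n + 1))" for n
    using kernelE[OF ker[of n]] by metis+
  have lift: "\<exists>h. arr h \<and> src h = src g \<and> tgt h = K n \<and> k n \<cdot> h = g"
    if "arr g" "tgt g = Term D n" "Diff D n \<cdot> g = Zero C (src g) (Term D (n + 1))" for g n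
    using kernelE[OF ker[of n]] that by metis
  have mono: "a = b" if "arr a" "arr b" "src a = src b" "tgt a = K n" "tgt b = K n" "k n \<cdot> a = k n \<cdot> b" for a b n
    using kernelE[OF ker[of n]] that by metis
  have [simp]: "K n \<in> Ob C" for n
    using src_in_Ob[of "k n"] by simp
  have "\<exists>\<sigma>. arr \<sigma> \<and> src \<sigma> = K n \<and> tgt \<sigma> = Term D (n - 1) \<and> Diff D (n - 1) \<cdot> \<sigma> = k n" for n
    by (rule exact_onD[OF ex, of "k n" "n - 1"]) auto
  then obtain \<sigma> where [simp]: "\<And>n. arr (\<sigma> n)" "\<And>n. src (\<sigma> n) = K n" "\<And>n. tgt (\<sigma> n) = Term D (n - 1)"
      and \<sigma>: "\<And>n. Diff D (n - 1) \<cdot> \<sigma> n = k n"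
    by metis
  have \<sigma>_Comp: "Diff D (n - 1) \<cdot> (\<sigma> n \<cdot> g) = k n \<cdot> g" if "arr g" "tgt g = K n" for n g
    using that by (simp flip: \<sigma>)
  have "\<exists>\<pi>. arr \<pi> \<and> src \<pi> = Term D n \<and> tgt \<pi> = K (n + 1) \<and> k (n + 1) \<cdot> \<pi> = Diff D n" for n
    using lift[of "Diff D n" "n + 1"] by simp
  then obtain \<pi> where [simp]: "\<And>n. arr (\<pi> n)" "\<And>n. src (\<pi> n) = Term D n" "\<And>n. tgt (\<pi> n) = K (n + 1)"
      and \<pi>: "\<And>n. k (n + 1) \<cdot> \<pi> n = Diff D n"
    by metis
  have [simp]: "\<pi> (n + 1) \<cdot> Diff D n = Zero C (Term D n) (K (n + 2))" for n
  proof (rule mono[where n = "n + 2"])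
    have "k (n + 2) \<cdot> (\<pi> (n + 1) \<cdot> Diff D n) = (k (n + 1 + 1) \<cdot> \<pi> (n + 1)) \<cdot> Diff D n"
      by simp
    also have "\<dots> = k (n + 2) \<cdot> Zero C (Term D n) (K (n + 2))"
      unfolding \<pi> by simp
    finally show "k (n + 2) \<cdot> (\<pi> (n + 1) \<cdot> Diff D n) = k (n + 2) \<cdot> Zero C (Term D n) (K (n + 2))" .
  qed simp_all
  define e where "e n = Id C (Term D n) \<boxplus> Neg C (Term D n) (Term D n) (\<sigma> (n + 1) \<cdot> \<pi> n)" for n
  have [simp]: "arr (e n)" "src (e n) = Term D n" "tgt (e n) = Term D n" for n
    by (simp_all add: e_def)
  have "Diff D n \<cdot> e n = Zero C (Term D n) (Term D (n + 1))" for n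
    using \<sigma>_Comp[of "\<pi> n" "n + 1"] by (simp add: e_def \<pi>)
  then have "\<exists>\<tau>. arr \<tau> \<and> src \<tau> = Term D n \<and> tgt \<tau> = K n \<and> k n \<cdot> \<tau> = e n" for n
    using lift[of "e n" n] by simp
  then obtain \<tau> where [simp]: "\<And>n. arr (\<tau> n)" "\<And>n. src (\<tau> n) = Term D n" "\<And>n. tgt (\<tau> n) = K n"
      and \<tau>: "\<And>n. k n \<cdot> \<tau> n = e n"
    by metis
  have \<tau>_Diff: "\<tau> (n + 1) \<cdot> Diff D n = \<pi> n" for n
  proof (rule mono[where n = "n + 1"])
    have "k (n + 1) \<cdot> (\<tau> (n + 1) \<cdot> Diff D n) = (k (n + 1) \<cdot> \<tau> (n + 1)) \<cdot> Diff D n"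
      by simp
    also have "\<dots> = k (n + 1) \<cdot> \<pi> n"
      unfolding \<tau> \<pi> by (simp add: e_def)
    finally show "k (n + 1) \<cdot> (\<tau> (n + 1) \<cdot> Diff D n) = k (n + 1) \<cdot> \<pi> n" .
  qed simp_all
  have "((\<lambda>n. Zero C (Term D n) (Term D n)), (\<lambda>n. Id C (Term D n))) \<in> homotopy_rel C D D"
  proof (rule homotopy_relI[where h = "\<lambda>n. \<sigma> n \<cdot> \<tau> n"])
    fix n
    have "Diff D (n - 1) \<cdot> (\<sigma> n \<cdot> \<tau> n) \<boxplus> (\<sigma> (n + 1) \<cdot> \<tau> (n + 1)) \<cdot> Diff D n = e n \<boxplus> \<sigma> (n + 1) \<cdot> \<pi> n"
      by (simp add: \<sigma>_Comp \<tau> \<tau>_Diff)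
    also have "\<dots> = Id C (Term D n)"
      by (simp add: e_def Add_assoc)
    finally show "Id C (Term D n) = Zero C (Term D n) (Term D n) \<boxplus>
        (Diff D (n - 1) \<cdot> (\<sigma> n \<cdot> \<tau> n) \<boxplus> (\<sigma> (n + 1) \<cdot> \<tau> (n + 1)) \<cdot> Diff D n)"
      by simp
  qed (auto simp: chain_maps_Id chain_maps_Zero in_Hom_iff)
  then show ?thesis
    unfolding contractible_def by (rule homotopy_rel_sym)
qed

lemma exact_on_if_contractible:
  assumes "contractible C D"
  shows "exact_on T D"
proof -
  have "((\<lambda>n. Zero C (Term D n) (Term D n)), (\<lambda>n. Id C (Term D n))) \<in> homotopy_rel C D D"
    using assms unfolding contractible_def by (rule homotopy_rel_sym)
  then show ?thesis
  proof (rule homotopy_relE)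
    fix h
    assume Id: "(\<lambda>n. Id C (Term D n)) \<in> chain_maps C D D"
      and [simp]: "\<And>n. arr (h n)" "\<And>n. src (h n) = Term D n" "\<And>n. tgt (h n) = Term D (n - 1)"
      and h: "\<And>n. Id C (Term D n) = Zero C (Term D n) (Term D n) \<boxplus> (Diff D (n - 1) \<cdot> h n \<boxplus> h (n + 1) \<cdot> Diff D n)"
    have [simp]: "cochain_complex C D"
      using chain_maps_typing(4)[OF Id] .
    show ?thesis
      unfolding exact_on_def
    proof (intro ballI allI impI)
      fix t n g
      assume "g \<in> Hom C t (Term D (n + 1))" and dg: "Diff D (n + 1) \<cdot> g = Zero C t (Term D (n + 2))"
      then have [simp]: "arr g" "src g = t" "tgt g = Term D (n + 1)"
        by (auto simp: in_Hom_iff)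
      have [simp]: "t \<in> Ob C" using src_in_Ob[of g] by simp
      have "g = Id C (Term D (n + 1)) \<cdot> g"
        by simp
      also have "\<dots> = Diff D n \<cdot> (h (n + 1) \<cdot> g)"
        unfolding h[of "n + 1"] by (simp add: dg)
      finally show "\<exists>h'\<in>Hom C t (Term D n). Diff D n \<cdot> h' = g"
        by (intro bexI[of _ "h (n + 1) \<cdot> g"]) (auto simp: in_Hom_iff)
    qed
  qed
qed

end

section \<open>Resolutions of bounded above complexes\<close>

text \<open>Dependent choice downwards along the integers, starting from prescribed values above \<open>N\<close>.\<close>

lemma ex_int_backward_sequence:
  fixes Q :: "int \<Rightarrow> 'a \<Rightarrow> bool" and R :: "int \<Rightarrow> 'a \<Rightarrow> 'a \<Rightarrow> bool"
  assumes init: "\<And>n. n > N \<Longrightarrow> Q n (s0 n)" "\<And>n. n > N \<Longrightarrow> R n (s0 (n + 1)) (s0 n)"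
    and step: "\<And>n s. n \<le> N \<Longrightarrow> Q (n + 1) s \<Longrightarrow> \<exists>s'. Q n s' \<and> R n s s'"
  shows "\<exists>S. \<forall>n. Q n (S n) \<and> R n (S (n + 1)) (S n)"
proof -
  have "\<exists>f. \<forall>k. (Q (N + 1 - int k) (f k) \<and> (k = 0 \<longrightarrow> f k = s0 (N + 1))) \<and> R (N - int k) (f k) (f (Suc k))"
  proof (rule dependent_nat_choice)
    show "\<exists>s. Q (N + 1 - int 0) s \<and> (0 = (0::nat) \<longrightarrow> s = s0 (N + 1))"
      using init(1)[of "N + 1"] by simp
    fix s k
    assume "Q (N + 1 - int k) s \<and> (k = 0 \<longrightarrow> s = s0 (N + 1))"
    then show "\<exists>s'. (Q (N + 1 - int (Suc k)) s' \<and> (Suc k = 0 \<longrightarrow> s' = s0 (N + 1))) \<and> R (N - int k) s s'"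
      using step[of "N - int k" s] by (simp add: algebra_simps)
  qed
  then obtain f where f: "\<And>k. Q (N + 1 - int k) (f k)" "f 0 = s0 (N + 1)" "\<And>k. R (N - int k) (f k) (f (Suc k))"
    by blast
  define S where "S n = (if n > N then s0 n else f (nat (N + 1 - n)))" for n
  have "Q n (S n) \<and> R n (S (n + 1)) (S n)" for n
  proof (cases "n > N")
    case True
    then show ?thesis
      using init by (simp add: S_def)
  next
    case False
    then have n: "S n = f (Suc (nat (N - n)))" "n = N - int (nat (N - n))"
      by (auto simp: S_def Suc_nat_eq_nat_zadd1 algebra_simps)
    have "S (n + 1) = f (nat (N - n))"
      using False f(2) by (auto simp: S_def)
    then show ?thesis
      using f(1)[of "Suc (nat (N - n))"] f(3)[of "nat (N - n)"] n by simp
  qed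
  then show ?thesis by blast
qed

context abelian_category
begin

text \<open>Every object \<open>Z\<close> receives an arrow from an object of \<open>T\<close> through which all arrows to \<open>Z\<close> from objects
  of \<open>T\<close> factor.\<close>

definition has_precovers :: "'o set \<Rightarrow> bool" where
  "has_precovers T \<longleftrightarrow> T \<subseteq> Ob C \<and>
     (\<forall>Z \<in> Ob C. \<exists>t \<in> T. \<exists>e \<in> Hom C t Z.
       \<forall>t' \<in> T. \<forall>u \<in> Hom C t' Z. \<exists>v \<in> Hom C t' t. e \<cdot> v = u)"

text \<open>The next term of a resolution: a precover of the object of pairs \<open>(x, y)\<close> with \<open>d' x = 0\<close> and
  \<open>p' x + b y = 0\<close>, which is a kernel.  The differential is the first component of the precover, and
  the augmentation is minus the second one, so that \<open>b p = p' d\<close>.\<close>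

lemma ex_resolution_step:
  assumes T: "has_precovers T"
    and [simp]: "arr d'" "arr p'" "arr b" "src p' = src d'" "tgt b = tgt p'"
  shows "\<exists>d p. arr d \<and> arr p \<and> src d \<in> T \<and> src p = src d \<and> tgt d = src d' \<and> tgt p = src b \<and>
    d' \<cdot> d = Zero C (src d) (tgt d') \<and> b \<cdot> p = p' \<cdot> d \<and>
    (\<forall>x y. arr x \<and> arr y \<and> src x \<in> T \<and> src y = src x \<and> tgt x = src d' \<and> tgt y = src b \<and>
      d' \<cdot> x = Zero C (src x) (tgt d') \<and> p' \<cdot> x \<boxplus> b \<cdot> y = Zero C (src x) (tgt p') \<longrightarrow>
      (\<exists>x'. arr x' \<and> src x' = src x \<and> tgt x' = src d \<and> d \<cdot> x' = x \<and> y \<boxplus> p \<cdot> x' = Zero C (src x) (src b)))"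
proof -
  have [simp]: "src d' \<in> Ob C" "tgt d' \<in> Ob C" "src b \<in> Ob C" "tgt p' \<in> Ob C"
    by (auto intro: src_in_Ob tgt_in_Ob)
  let ?S = "biprod C (src d') (src b)" and ?S' = "biprod C (tgt d') (tgt p')"
  define m where "m = in1 ?S' \<cdot> (d' \<cdot> pr1 ?S) \<boxplus> in2 ?S' \<cdot> (p' \<cdot> pr1 ?S \<boxplus> b \<cdot> pr2 ?S)"
  have [simp]: "arr m" "src m = vertex ?S" "tgt m = vertex ?S'"
    by (simp_all add: m_def)
  have pr_m: "pr1 ?S' \<cdot> (m \<cdot> g) = d' \<cdot> (pr1 ?S \<cdot> g)" "pr2 ?S' \<cdot> (m \<cdot> g) = p' \<cdot> (pr1 ?S \<cdot> g) \<boxplus> b \<cdot> (pr2 ?S \<cdot> g)"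
    if "arr g" "tgt g = vertex ?S" for g
    using that src_in_Ob[OF that(1)] by (simp_all add: m_def)
  obtain K k where ker: "is_kernel C (vertex ?S) (vertex ?S') m K k"
    using ex_kernel[of m "vertex ?S" "vertex ?S'"] by (auto simp: in_Hom_iff)
  then have [simp]: "arr k" "src k = K" "tgt k = vertex ?S" and mk: "m \<cdot> k = Zero C K (vertex ?S')"
    and lift: "\<And>g. arr g \<Longrightarrow> tgt g = vertex ?S \<Longrightarrow> m \<cdot> g = Zero C (src g) (vertex ?S')
      \<Longrightarrow> \<exists>h. arr h \<and> src h = src g \<and> tgt h = K \<and> k \<cdot> h = g"
    by (auto elim: kernelE)
  have [simp]: "K \<in> Ob C" using src_in_Ob[of k] by simp
  obtain t e where t: "t \<in> T" "t \<in> Ob C" and "e \<in> Hom C t K"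
    and cover: "\<forall>t' \<in> T. \<forall>u \<in> Hom C t' K. \<exists>v \<in> Hom C t' t. e \<cdot> v = u"
    using T \<open>K \<in> Ob C\<close> unfolding has_precovers_def by blast
  then have [simp]: "arr e" "src e = t" "tgt e = K"
    by (auto simp: in_Hom_iff)
  have e: "\<exists>v. arr v \<and> src v = src u \<and> tgt v = t \<and> e \<cdot> v = u"
    if "arr u" "src u \<in> T" "tgt u = K" for u
    using cover that by (metis in_Hom_iff)
  have mke: "m \<cdot> (k \<cdot> e) = Zero C t (vertex ?S')"
  proof -
    have "m \<cdot> (k \<cdot> e) = (m \<cdot> k) \<cdot> e"
      by simp
    then show ?thesis
      unfolding mk by simp
  qed
  define d where "d = pr1 ?S \<cdot> (k \<cdot> e)"
  define q where "q = pr2 ?S \<cdot> (k \<cdot> e)"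
  define p where "p = Neg C t (src b) q"
  have [simp]: "arr d" "src d = t" "tgt d = src d'" "arr q" "src q = t" "tgt q = src b"
    "arr p" "src p = t" "tgt p = src b"
    by (simp_all add: d_def q_def p_def)
  have dd: "d' \<cdot> d = Zero C t (tgt d')"
    using pr_m(1)[of "k \<cdot> e"] t by (simp add: mke d_def)
  have "p' \<cdot> d \<boxplus> b \<cdot> q = Zero C t (tgt p')"
    using pr_m(2)[of "k \<cdot> e"] t by (simp add: mke d_def q_def)
  then have pd: "b \<cdot> p = p' \<cdot> d"
    using Add_eq_Zero_imp[of "p' \<cdot> d" "b \<cdot> q" t "tgt p'"] by (simp add: p_def)
  have "\<exists>x'. arr x' \<and> src x' = src x \<and> tgt x' = t \<and> d \<cdot> x' = x \<and> y \<boxplus> p \<cdot> x' = Zero C (src x) (src b)"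
    if [simp]: "arr x" "arr y" "src y = src x" "tgt x = src d'" "tgt y = src b"
      and "src x \<in> T" and x: "d' \<cdot> x = Zero C (src x) (tgt d')" and y: "p' \<cdot> x \<boxplus> b \<cdot> y = Zero C (src x) (tgt p')" for x y
  proof -
    have [simp]: "src x \<in> Ob C" using src_in_Ob by simp
    define g where "g = in1 ?S \<cdot> x \<boxplus> in2 ?S \<cdot> y"
    have [simp]: "arr g" "src g = src x" "tgt g = vertex ?S" and g: "pr1 ?S \<cdot> g = x" "pr2 ?S \<cdot> g = y"
      by (simp_all add: g_def)
    have "m \<cdot> g = Zero C (src x) (vertex ?S')"
      by (rule biprod_eqI[where X = "tgt d'" and Y = "tgt p'"]) (auto simp: pr_m g x y)
    then obtain u where [simp]: "arr u" "src u = src x" "tgt u = K" and u: "k \<cdot> u = g"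
      using lift[of g] by auto
    obtain v where [simp]: "arr v" "src v = src x" "tgt v = t" and v: "e \<cdot> v = u"
      using e[of u] \<open>src x \<in> T\<close> by auto
    have "d \<cdot> v = x" "q \<cdot> v = y"
      by (simp_all add: d_def q_def v u g)
    then show ?thesis
      by (intro exI[of _ v]) (simp add: p_def)
  qed
  then show ?thesis
    using dd pd t by (intro exI[of _ d] exI[of _ p]) auto
qed

text \<open>The terms are built by downward recursion, starting from zero objects in the degrees in which
  \<open>X\<close> vanishes.  The step makes each cocycle \<open>(x, y)\<close> of the cone, defined on a test object, the
  coboundary of a pair \<open>(- x', 0)\<close>.\<close>

lemma ex_resolution:
  assumes T: "has_precovers T" and [simp]: "cochain_complex C X" and bounded: "bounded_above C X"
  shows "\<exists>P p. (\<forall>n. Term P n \<in> T \<or> zero_object C (Term P n)) \<and> quasi_iso_on T P X p"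
proof -
  obtain N where N: "\<And>n. n > N \<Longrightarrow> zero_object C (Term X n)"
    using bounded unfolding bounded_above_def by blast
  obtain Z where Z: "zero_object C Z" using ex_zero_object by blast
  then have [simp]: "Z \<in> Ob C" by (rule zero_object_Ob)
  \<comment> \<open>A state in degree \<open>n\<close> consists of the differential and the augmentation that leave that
    degree; the term itself is their common source.\<close>
  define Q where "Q n s = (case s of (d, p) \<Rightarrow> arr d \<and> arr p \<and> (src d \<in> T \<or> zero_object C (src d)) \<and>
     src p = src d \<and> tgt p = Term X n)" for n and s :: "'m \<times> 'm"
  define R where "R n s' s = (case s' of (d', p') \<Rightarrow> case s of (d, p) \<Rightarrow>
    tgt d = src d' \<and> d' \<cdot> d = Zero C (src d) (tgt d') \<and> Diff X n \<cdot> p = p' \<cdot> d \<and>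
    (\<forall>x y. arr x \<and> arr y \<and> src x \<in> T \<and> src y = src x \<and> tgt x = src d' \<and> tgt y = Term X n \<and>
      d' \<cdot> x = Zero C (src x) (tgt d') \<and> p' \<cdot> x \<boxplus> Diff X n \<cdot> y = Zero C (src x) (Term X (n + 1)) \<longrightarrow>
      (\<exists>x'. arr x' \<and> src x' = src x \<and> tgt x' = src d \<and> d \<cdot> x' = x \<and> y \<boxplus> p \<cdot> x' = Zero C (src x) (Term X n))))"
    for n and s' s :: "'m \<times> 'm"
  have "\<exists>S. \<forall>n. Q n (S n) \<and> R n (S (n + 1)) (S n)"
  proof (rule ex_int_backward_sequence)
    fix n assume n: "n > N"
    show "Q n (Zero C Z Z, Zero C Z (Term X n))"
      using Z by (simp add: Q_def)
    have "\<exists>x'. arr x' \<and> src x' = src x \<and> tgt x' = Z \<and> Zero C Z Z \<cdot> x' = x \<and> y \<boxplus> Zero C Z (Term X n) \<cdot> x' = Zero C (src x) (Term X n)"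
      if xy: "arr x" "arr y" "src y = src x" "tgt x = Z" "tgt y = Term X n" for x y
    proof -
      define t where "t = src x"
      then have [simp]: "t \<in> Ob C" "x = Zero C t Z" "y = Zero C t (Term X n)"
        using zero_object_target[OF Z xy(1,4)] zero_object_target[OF N[OF n] xy(2,5)] xy src_in_Ob by simp_all
      show ?thesis
        by (intro exI[of _ "Zero C t Z"]) simp
    qed
    then show "R n (Zero C Z Z, Zero C Z (Term X (n + 1))) (Zero C Z Z, Zero C Z (Term X n))"
      by (auto simp: R_def)
  next
    fix n and s :: "'m \<times> 'm" assume "Q (n + 1) s"
    then obtain d' p' where [simp]: "s = (d', p')" "arr d'" "arr p'" "src p' = src d'" "tgt p' = Term X (n + 1)"
      by (auto simp: Q_def split: prod.splits)
    obtain d p where "arr d \<and> arr p \<and> src d \<in> T \<and> src p = src d \<and> tgt d = src d' \<and> tgt p = Term X n \<and>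
      d' \<cdot> d = Zero C (src d) (tgt d') \<and> Diff X n \<cdot> p = p' \<cdot> d \<and>
      (\<forall>x y. arr x \<and> arr y \<and> src x \<in> T \<and> src y = src x \<and> tgt x = src d' \<and> tgt y = Term X n \<and>
      d' \<cdot> x = Zero C (src x) (tgt d') \<and> p' \<cdot> x \<boxplus> Diff X n \<cdot> y = Zero C (src x) (Term X (n + 1)) \<longrightarrow>
      (\<exists>x'. arr x' \<and> src x' = src x \<and> tgt x' = src d \<and> d \<cdot> x' = x \<and> y \<boxplus> p \<cdot> x' = Zero C (src x) (Term X n)))"
      using ex_resolution_step[OF T, of d' p' "Diff X n"] by auto
    then show "\<exists>s'. Q n s' \<and> R n s s'"
      by (intro exI[of _ "(d, p)"]) (simp add: Q_def R_def)
  qed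
  then obtain S where S: "\<And>n. Q n (S n)" "\<And>n. R n (S (n + 1)) (S n)"
    by blast
  define P where "P = \<lparr>Term = \<lambda>n. src (fst (S n)), Diff = \<lambda>n. fst (S n)\<rparr>"
  define p where "p n = snd (S n)" for n
  have [simp]: "arr (Diff P n)" "src (Diff P n) = Term P n" "arr (p n)" "src (p n) = Term P n" "tgt (p n) = Term X n"
    and P_T: "Term P n \<in> T \<or> zero_object C (Term P n)" for n
    using S(1)[of n] by (auto simp: Q_def P_def p_def)
  have [simp]: "tgt (Diff P n) = Term P (n + 1)" for n
    using S(2)[of n] by (auto simp: R_def P_def p_def split: prod.splits)
  have dd: "Diff P (n + 1) \<cdot> Diff P n = Zero C (Term P n) (Term P (n + 2))"
    and pd: "Diff X n \<cdot> p n = p (n + 1) \<cdot> Diff P n"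
    and ex: "\<And>x y. arr x \<Longrightarrow> arr y \<Longrightarrow> src x \<in> T \<Longrightarrow> src y = src x \<Longrightarrow> tgt x = Term P (n + 1) \<Longrightarrow> tgt y = Term X n \<Longrightarrow>
      Diff P (n + 1) \<cdot> x = Zero C (src x) (Term P (n + 2)) \<Longrightarrow>
      p (n + 1) \<cdot> x \<boxplus> Diff X n \<cdot> y = Zero C (src x) (Term X (n + 1)) \<Longrightarrow>
      (\<exists>x'. arr x' \<and> src x' = src x \<and> tgt x' = Term P n \<and> Diff P n \<cdot> x' = x \<and> y \<boxplus> p n \<cdot> x' = Zero C (src x) (Term X n))" for n
  proof -
    have "tgt (fst (S (n + 1))) = Term P (n + 2)" "fst (S m) = Diff P m" "snd (S m) = p m" for m
      using \<open>\<And>n. tgt (Diff P n) = Term P (n + 1)\<close>[of "n + 1"] by (simp_all add: P_def p_def)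
    then have "S m = (Diff P m, p m)" for m
      by (metis prod.collapse)
    then show "Diff P (n + 1) \<cdot> Diff P n = Zero C (Term P n) (Term P (n + 2))"
      "Diff X n \<cdot> p n = p (n + 1) \<cdot> Diff P n"
      "\<And>x y. arr x \<Longrightarrow> arr y \<Longrightarrow> src x \<in> T \<Longrightarrow> src y = src x \<Longrightarrow> tgt x = Term P (n + 1) \<Longrightarrow> tgt y = Term X n \<Longrightarrow>
      Diff P (n + 1) \<cdot> x = Zero C (src x) (Term P (n + 2)) \<Longrightarrow>
      p (n + 1) \<cdot> x \<boxplus> Diff X n \<cdot> y = Zero C (src x) (Term X (n + 1)) \<Longrightarrow>
      (\<exists>x'. arr x' \<and> src x' = src x \<and> tgt x' = Term P n \<and> Diff P n \<cdot> x' = x \<and> y \<boxplus> p n \<cdot> x' = Zero C (src x) (Term X n))"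
      using S(2)[of n] by (auto simp: R_def)
  qed
  have [simp]: "Term P n \<in> Ob C" for n
    using src_in_Ob[of "Diff P n"] by simp
  have P [simp]: "cochain_complex C P"
    by (rule cochain_complexI) (auto simp: in_Hom_iff dd)
  have p: "p \<in> chain_maps C P X"
    by (rule chain_mapsI) (auto simp: in_Hom_iff pd)
  have "quasi_iso_on T P X p"
  proof (rule quasi_iso_onI[OF p])
    fix n x y
    assume xy [simp]: "arr x" "arr y" "src y = src x" "tgt x = Term P (n + 2)" "tgt y = Term X (n + 1)"
      and t: "src x \<in> T"
      and dx: "Diff P (n + 2) \<cdot> x = Zero C (src x) (Term P (n + 3))"
      and dy: "p (n + 2) \<cdot> x \<boxplus> Diff X (n + 1) \<cdot> y = Zero C (src x) (Term X (n + 2))"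
    have "src x \<in> Ob C" using src_in_Ob by simp
    moreover obtain x' where "arr x'" "src x' = src x" "tgt x' = Term P (n + 1)" "Diff P (n + 1) \<cdot> x' = x"
       "y \<boxplus> p (n + 1) \<cdot> x' = Zero C (src x) (Term X (n + 1))"
      using ex[of x y "n + 1"] t dx dy by (auto simp: add.assoc)
    ultimately show "\<exists>x' y'. arr x' \<and> arr y' \<and> src x' = src x \<and> src y' = src x \<and>
        tgt x' = Term P (n + 1) \<and> tgt y' = Term X n \<and>
        Diff P (n + 1) \<cdot> x' = x \<and> y \<boxplus> p (n + 1) \<cdot> x' = Diff X n \<cdot> y'"
      by (intro exI[of _ x'] exI[of _ "Zero C (src x) (Term X n)"]) simp
  qed
  with P_T show ?thesis by blast
qed

end

section \<open>Summands of free objects\<close>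

context abelian_category
begin

lemma is_biproduct_zero:
  assumes [simp]: "X \<in> Ob C" and Z: "zero_object C Z"
  shows "is_biproduct C X Z \<lparr>vertex = X, in1 = Id C X, in2 = Zero C Z X, pr1 = Id C X, pr2 = Zero C X Z\<rparr>"
    and "is_biproduct C Z X \<lparr>vertex = X, in1 = Zero C Z X, in2 = Id C X, pr1 = Zero C X Z, pr2 = Id C X\<rparr>"
proof -
  have [simp]: "Z \<in> Ob C" using Z by (rule zero_object_Ob)
  have "Id C Z = Zero C Z Z"
    using zero_object_target[OF Z, of "Id C Z"] by simp
  then show "is_biproduct C X Z \<lparr>vertex = X, in1 = Id C X, in2 = Zero C Z X, pr1 = Id C X, pr2 = Zero C X Z\<rparr>"
    "is_biproduct C Z X \<lparr>vertex = X, in1 = Zero C Z X, in2 = Id C X, pr1 = Zero C X Z, pr2 = Id C X\<rparr>"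
    by (simp_all add: is_biproduct_def in_Hom_iff)
qed

lemma direct_summand_self:
  assumes "X \<in> Ob C"
  shows "direct_summand C X X"
proof -
  obtain Z where "zero_object C Z"
    using ex_zero_object by blast
  then show ?thesis
    unfolding direct_summand_def by (intro exI conjI) (rule is_biproduct_zero(1)[OF assms], assumption, simp)
qed

lemma direct_summand_zero:
  assumes "X \<in> Ob C" "zero_object C Z"
  shows "direct_summand C Z X"
  unfolding direct_summand_def
  by (intro exI conjI) (rule is_biproduct_zero(2)[OF assms], simp)

end

section \<open>Adjunctions\<close>

lemma adjunctionE:
  assumes "adjunction B A L F"
  obtains \<phi> where "is_functor B A L" "is_functor A B F"
    "\<And>W Z. W \<in> Ob B \<Longrightarrow> Z \<in> Ob A \<Longrightarrow> bij_betw (\<phi> W Z) (Hom A (on_ob L W) Z) (Hom B W (on_ob F Z))"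
    "\<And>W W' Z f a. f \<in> Hom A (on_ob L W) Z \<Longrightarrow> a \<in> Hom B W' W \<Longrightarrow> W \<in> Ob B \<Longrightarrow>
       \<phi> W' Z (f \<cdot>\<^bsub>A\<^esub> on_hom L a) = \<phi> W Z f \<cdot>\<^bsub>B\<^esub> a"
    "\<And>W Z Z' f b. f \<in> Hom A (on_ob L W) Z \<Longrightarrow> b \<in> Hom A Z Z' \<Longrightarrow> W \<in> Ob B \<Longrightarrow>
       \<phi> W Z' (b \<cdot>\<^bsub>A\<^esub> f) = on_hom F b \<cdot>\<^bsub>B\<^esub> \<phi> W Z f"
proof -
  from assms obtain \<phi> where "is_functor B A L" "is_functor A B F"
    and "\<forall>W \<in> Ob B. \<forall>Z \<in> Ob A. bij_betw (\<phi> W Z) (Hom A (on_ob L W) Z) (Hom B W (on_ob F Z))"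
    and "\<forall>W W' Z. \<forall>f \<in> Hom A (on_ob L W) Z. \<forall>a \<in> Hom B W' W. W \<in> Ob B \<longrightarrow>
       \<phi> W' Z (f \<cdot>\<^bsub>A\<^esub> on_hom L a) = \<phi> W Z f \<cdot>\<^bsub>B\<^esub> a"
    and "\<forall>W Z Z'. \<forall>f \<in> Hom A (on_ob L W) Z. \<forall>b \<in> Hom A Z Z'. W \<in> Ob B \<longrightarrow>
       \<phi> W Z' (b \<cdot>\<^bsub>A\<^esub> f) = on_hom F b \<cdot>\<^bsub>B\<^esub> \<phi> W Z f"
    unfolding adjunction_def by blast
  then show thesis
    by (intro that[of \<phi>]) simp_all
qed

text \<open>An additive functor \<open>F\<close> between abelian categories with a left adjoint \<open>L\<close>.\<close>

locale abelian_adjunction = A: abelian_category A + B: abelian_category B + F: additive_functor A B F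
  for A :: "('o, 'm, 'y) preadditive_category_scheme"
    and B :: "('p, 'n, 'z) preadditive_category_scheme"
    and F :: "('o, 'm, 'p, 'n) functor_data"
    and L :: "('p, 'n, 'o, 'm) functor_data" +
  assumes adj: "adjunction B A L F"
begin

text \<open>The objects \<open>L W\<close>, which serve as test objects.\<close>

abbreviation free_objects :: "'o set" where
  "free_objects \<equiv> on_ob L ` Ob B"

lemma free_objects_subset: "free_objects \<subseteq> Ob A"
proof -
  have "is_functor B A L"
    using adj by (simp add: adjunction_def)
  then show ?thesis
    by (auto intro: is_functor.on_ob_in)
qed

lemma F_typing [simp]:
  assumes "A.arr f"
  shows "B.arr (on_hom F f)" "B.src (on_hom F f) = on_ob F (A.src f)" "B.tgt (on_hom F f) = on_ob F (A.tgt f)"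
proof -
  have "on_hom F f \<in> Hom B (on_ob F (A.src f)) (on_ob F (A.tgt f))"
    by (rule F.on_hom_in) (use assms in \<open>simp add: A.in_Hom_iff\<close>)
  then show "B.arr (on_hom F f)" "B.src (on_hom F f) = on_ob F (A.src f)" "B.tgt (on_hom F f) = on_ob F (A.tgt f)"
    by (simp_all add: B.in_Hom_iff)
qed

lemma F_Zero:
  assumes "X \<in> Ob A" "Y \<in> Ob A"
  shows "on_hom F (Zero A X Y) = Zero B (on_ob F X) (on_ob F Y)"
proof -
  have "on_hom F (Zero A X Y) \<boxplus>\<^bsub>B\<^esub> on_hom F (Zero A X Y) = on_hom F (Zero A X Y \<boxplus>\<^bsub>A\<^esub> Zero A X Y)"
    by (rule F.on_hom_Add[of _ X Y, symmetric]) (use assms in \<open>auto simp: A.in_Hom_iff\<close>)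
  then show ?thesis
    using B.idem_Zero[of "on_hom F (Zero A X Y)"] assms by simp
qed

lemma cochain_complex_map:
  assumes S: "cochain_complex A S"
  shows "cochain_complex B (map_complex F S)"
proof (rule B.cochain_complexI)
  note [simp] = A.complex_typing[OF S]
  fix n
  show "Term (map_complex F S) n \<in> Ob B"
    "Diff (map_complex F S) n \<in> Hom B (Term (map_complex F S) n) (Term (map_complex F S) (n + 1))"
    by (auto simp: map_complex_def B.in_Hom_iff F.on_ob_in)
  have "on_hom F (Diff S (n + 1)) \<cdot>\<^bsub>B\<^esub> on_hom F (Diff S n) = on_hom F (Diff S (n + 1) \<cdot>\<^bsub>A\<^esub> Diff S n)"
    by (rule F.on_hom_Comp[symmetric]) (auto simp: A.in_Hom_iff)
  then show "Diff (map_complex F S) (n + 1) \<cdot>\<^bsub>B\<^esub> Diff (map_complex F S) n =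
      Zero B (Term (map_complex F S) n) (Term (map_complex F S) (n + 2))"
    using S by (simp add: map_complex_def F_Zero)
qed

text \<open>The adjunction identifies \<open>Hom(W, F S)\<close> with \<open>Hom(L W, S)\<close>.  It matches zero arrows with zero
  arrows since \<open>F\<close> is additive; the bijections need not be assumed additive.\<close>

lemma exact_on_map_iff:
  assumes S: "cochain_complex A S"
  shows "B.exact_on (Ob B) (map_complex F S) \<longleftrightarrow> A.exact_on free_objects S"
proof (rule adjunctionE[OF adj])
  note [simp] = A.complex_typing[OF S]
  fix \<phi>
  assume L: "is_functor B A L"
    and bij: "\<And>W Z. W \<in> Ob B \<Longrightarrow> Z \<in> Ob A \<Longrightarrow> bij_betw (\<phi> W Z) (Hom A (on_ob L W) Z) (Hom B W (on_ob F Z))"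
    and nat: "\<And>W Z Z' f b. f \<in> Hom A (on_ob L W) Z \<Longrightarrow> b \<in> Hom A Z Z' \<Longrightarrow> W \<in> Ob B \<Longrightarrow>
       \<phi> W Z' (b \<cdot>\<^bsub>A\<^esub> f) = on_hom F b \<cdot>\<^bsub>B\<^esub> \<phi> W Z f"
  have inj: "\<phi> W Z f = \<phi> W Z g \<longleftrightarrow> f = g"
    if "W \<in> Ob B" "Z \<in> Ob A" "f \<in> Hom A (on_ob L W) Z" "g \<in> Hom A (on_ob L W) Z" for W Z f g
    using bij[OF that(1,2)] that(3,4) by (auto simp: bij_betw_def inj_on_eq_iff)
  have surj: "Hom B W (on_ob F Z) = \<phi> W Z ` Hom A (on_ob L W) Z" if "W \<in> Ob B" "Z \<in> Ob A" for W Z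
    using bij[OF that] by (simp add: bij_betw_def)
  have Diff: "Diff S n \<in> Hom A (Term S n) (Term S (n + 1))" for n
    by (simp add: A.in_Hom_iff)
  have zero: "\<phi> W Z (Zero A (on_ob L W) Z) = Zero B W (on_ob F Z)" if W: "W \<in> Ob B" and Z: "Z \<in> Ob A" for W Z
  proof -
    have [simp]: "on_ob L W \<in> Ob A" "on_ob F Z \<in> Ob B"
      using is_functor.on_ob_in[OF L W] F.on_ob_in[OF Z] by simp_all
    have 0: "Zero A (on_ob L W) Z \<in> Hom A (on_ob L W) Z" "Zero A Z Z \<in> Hom A Z Z"
      using Z by (auto simp: A.in_Hom_iff)
    then have "\<phi> W Z (Zero A (on_ob L W) Z) \<in> Hom B W (on_ob F Z)"
      using surj[OF W Z] by blast
    then show ?thesis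
      using nat[OF 0 W] Z by (simp add: F_Zero B.in_Hom_iff)
  qed
  have 1: "(Diff S (n + 1) \<cdot>\<^bsub>A\<^esub> g = Zero A (on_ob L W) (Term S (n + 2))) \<longleftrightarrow>
    (on_hom F (Diff S (n + 1)) \<cdot>\<^bsub>B\<^esub> \<phi> W (Term S (n + 1)) g = Zero B W (on_ob F (Term S (n + 2))))"
    if W: "W \<in> Ob B" and g: "g \<in> Hom A (on_ob L W) (Term S (n + 1))" for W g n
  proof -
    have "Diff S (n + 1) \<cdot>\<^bsub>A\<^esub> g \<in> Hom A (on_ob L W) (Term S (n + 2))"
      "Zero A (on_ob L W) (Term S (n + 2)) \<in> Hom A (on_ob L W) (Term S (n + 2))"
      using W g free_objects_subset by (auto simp: A.in_Hom_iff)
    from inj[OF W _ this] show ?thesis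
      using nat[OF g Diff W] W by (simp add: zero)
  qed
  have 2: "(Diff S n \<cdot>\<^bsub>A\<^esub> h = g) \<longleftrightarrow>
    (on_hom F (Diff S n) \<cdot>\<^bsub>B\<^esub> \<phi> W (Term S n) h = \<phi> W (Term S (n + 1)) g)"
    if W: "W \<in> Ob B" and g: "g \<in> Hom A (on_ob L W) (Term S (n + 1))" and h: "h \<in> Hom A (on_ob L W) (Term S n)" for W g h n
  proof -
    have "Diff S n \<cdot>\<^bsub>A\<^esub> h \<in> Hom A (on_ob L W) (Term S (n + 1))"
      using h by (auto simp: A.in_Hom_iff)
    from inj[OF W _ this g] show ?thesis
      using nat[OF h Diff W] by simp
  qed
  show ?thesis
    unfolding A.exact_on_def B.exact_on_def map_complex_def
    by (simp add: surj 1 2)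
qed

lemma F_split_acyclic_iff: "F_split_acyclic A B F S \<longleftrightarrow> S \<in> A.exact_complexes free_objects"
proof -
  have "contractible B (map_complex F S) \<longleftrightarrow> A.exact_on free_objects S" if "cochain_complex A S"
    using B.contractible_if_exact_on[OF cochain_complex_map[OF that]]
      B.exact_on_if_contractible[of "map_complex F S" "Ob B"] exact_on_map_iff[OF that] by auto
  then show ?thesis
    by (auto simp: F_split_acyclic_def A.exact_complexes_def)
qed

lemma D_F_eq: "D_F A B F = verdier_localization A (A.exact_complexes free_objects)"
proof -
  have "{S. F_split_acyclic A B F S} = A.exact_complexes free_objects"
    using F_split_acyclic_iff by blast
  then show ?thesis
    by (simp only: D_F_def)
qed

text \<open>The counit \<open>L (F Z) \<rightarrow> Z\<close> is a precover.\<close>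

lemma has_precovers_free_objects: "A.has_precovers free_objects"
  unfolding A.has_precovers_def
proof (rule adjunctionE[OF adj], intro conjI ballI)
  show "free_objects \<subseteq> Ob A" by (rule free_objects_subset)
next
  fix \<phi> Z
  assume L: "is_functor B A L"
    and bij: "\<And>W Z. W \<in> Ob B \<Longrightarrow> Z \<in> Ob A \<Longrightarrow> bij_betw (\<phi> W Z) (Hom A (on_ob L W) Z) (Hom B W (on_ob F Z))"
    and nat: "\<And>W W' Z f a. f \<in> Hom A (on_ob L W) Z \<Longrightarrow> a \<in> Hom B W' W \<Longrightarrow> W \<in> Ob B \<Longrightarrow>
       \<phi> W' Z (f \<cdot>\<^bsub>A\<^esub> on_hom L a) = \<phi> W Z f \<cdot>\<^bsub>B\<^esub> a"
    and Z: "Z \<in> Ob A"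
  have FZ: "on_ob F Z \<in> Ob B" using Z by (rule F.on_ob_in)
  obtain e where e: "e \<in> Hom A (on_ob L (on_ob F Z)) Z" "\<phi> (on_ob F Z) Z e = Id B (on_ob F Z)"
    using B.Id_in[OF FZ] unfolding bij_betw_imp_surj_on[OF bij[OF FZ Z], symmetric] by auto
  have "\<exists>v \<in> Hom A (on_ob L W) (on_ob L (on_ob F Z)). e \<cdot>\<^bsub>A\<^esub> v = u" if W: "W \<in> Ob B" and u: "u \<in> Hom A (on_ob L W) Z" for W u
  proof -
    have a: "\<phi> W Z u \<in> Hom B W (on_ob F Z)"
      using bij[OF W Z] u by (auto simp: bij_betw_def)
    then have La: "on_hom L (\<phi> W Z u) \<in> Hom A (on_ob L W) (on_ob L (on_ob F Z))"
      using is_functor.on_hom_in[OF L] by blast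
    have "\<phi> W Z (e \<cdot>\<^bsub>A\<^esub> on_hom L (\<phi> W Z u)) = \<phi> W Z u"
      using nat[OF e(1) a FZ] e(2) a B.Id_Comp by simp
    moreover have "e \<cdot>\<^bsub>A\<^esub> on_hom L (\<phi> W Z u) \<in> Hom A (on_ob L W) Z"
      using La e(1) by (rule A.Comp_in)
    ultimately have "e \<cdot>\<^bsub>A\<^esub> on_hom L (\<phi> W Z u) = u"
      using bij[OF W Z] u by (auto simp: bij_betw_def inj_on_def)
    with La show ?thesis by blast
  qed
  with e(1) FZ show "\<exists>t\<in>free_objects. \<exists>e\<in>Hom A t Z. \<forall>t'\<in>free_objects. \<forall>u\<in>Hom A t' Z. \<exists>v\<in>Hom A t' t. e \<cdot>\<^bsub>A\<^esub> v = u"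
    by blast
qed

lemma F_projective_if_free_or_zero:
  assumes "P \<in> free_objects \<or> zero_object A P"
  shows "F_projective A B L P"
  using assms
proof
  assume "P \<in> free_objects"
  then show ?thesis
    using free_objects_subset A.direct_summand_self unfolding F_projective_def by blast
next
  assume P: "zero_object A P"
  obtain W where "W \<in> Ob B"
    using B.ex_zero_object B.zero_object_Ob by blast
  then show ?thesis
    using free_objects_subset A.direct_summand_zero[OF _ P] unfolding F_projective_def by blast
qed

theorem ex_F_projective_resolution:
  assumes X: "cochain_complex A X" "bounded_above A X"
  shows "\<exists>P p. F_projective_resolution A B F L X P p"
proof -
  obtain P p where P: "\<And>n. Term P n \<in> free_objects \<or> zero_object A (Term P n)"
    and p: "A.quasi_iso_on free_objects P X p"
    using A.ex_resolution[OF has_precovers_free_objects X] by blast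
  then have p': "p \<in> chain_maps A P X"
    by (simp add: A.quasi_iso_on_def)
  have "zero_object (D_F A B F) (cone A P X p)"
    unfolding D_F_eq
    by (rule A.zero_object_verdier_localization)
      (use p A.exact_on_cone_iff[OF p'] A.cochain_complex_cone[OF p'] in auto)
  then have "F_projective_resolution A B F L X P p"
    unfolding F_projective_resolution_def
    using p' A.chain_maps_typing(4)[OF p'] F_projective_if_free_or_zero[OF P] by blast
  then show ?thesis by blast
qed

end

section \<open>Existence of resolutions\<close>

theorem theorem5p3:
  fixes A :: "('o, 'm) preadditive_category"
    and B :: "('p, 'n) preadditive_category"
    and F :: "('o, 'm, 'p, 'n) functor_data"
    and L R :: "('p, 'n, 'o, 'm) functor_data"
    and X :: "('o, 'm) complex_data"
  assumes "abelian_category A" and "abelian_category B"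
    and "additive_functor A B F" and "faithful A F"
    and "adjunction B A L F" and "adjunction A B F R"
    and "{P. F_projective A B L P} = {I. F_injective A B R I}"
    and "X \<in> Ob (homotopy_category A)" and "bounded_above A X"
  shows "\<exists>P p. F_projective_resolution A B F L X P p"
proof -
  interpret abelian_adjunction A B F L
    by (intro abelian_adjunction.intro abelian_adjunction_axioms.intro assms)
  show ?thesis
    by (rule ex_F_projective_resolution) (use assms(8,9) A.Ob_homotopy_category in auto)
qed

end
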